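(* Let $n\geq 2$, let $\mathfrak{g}=\mathfrak{sp}(2n,\mathbb{C})$, and let $\lambda\in\mathbb{C}$ with $\lambda\neq-\frac{1}{16(n+1)}$. Then the two-sided ideal in the tensor algebra $\bigotimes\mathfrak{g}$ generated by all elements $$X\otimes Y-X\circledcirc Y-\tfrac12[X,Y]-\lambda\langle X,Y\rangle,\qquad X,Y\in\mathfrak{g},$$ contains $\mathfrak{g}=\mathfrak{sp}(2n,\mathbb{C})$, the first graded piece of $\bigotimes\mathfrak{g}$.
   Context: $\mathfrak{sp}(2n,\mathbb{C})$ is the Lie algebra of endomorphisms of $\mathbb{C}^{2n}$ preserving a non-degenerate skew form. For a complex simple Lie algebra $\mathfrak{g}$, $\bigotimes\mathfrak{g}=\bigoplus_{s\ge0}\bigotimes^s\mathfrak{g}$ is the full (unital, associative) tensor algebra over $\mathbb{C}$. The Cartan product $\mathfrak{g}\circledcirc\mathfrak{g}\subset\mathfrak{g}\otimes\mathfrak{g}$ is the unique irreducible component of $\mathfrak{g}\otimes\mathfrak{g}$ whose highest weight is twice the highest weight of $\mathfrak{g}$ (the adjoint representation). The map $X\otimes Y\mapsto X\circledcirc Y\in\mathfrak{g}\circledcirc\mathfrak{g}\subset\mathfrak{g}\otimes\mathfrak{g}$ denotes the $\mathfrak{g}$-invariant projection of $\mathfrak{g}\otimes\mathfrak{g}$ onto this component. $[X,Y]$ is the Lie bracket and $\langle X,Y\rangle=\mathrm{tr}(\mathrm{ad}_X\,\mathrm{ad}_Y)$ is the Killing form. The displayed generators are elements of $\bigotimes^2\mathfrak{g}\oplus\mathfrak{g}\oplus\mathbb{C}\subset\bigotimes\mathfrak{g}$.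 *)

theory Defs
  imports "HOL-Analysis.Analysis" "HOL-Library.Poly_Mapping"
begin

section \<open>Complex vector spaces and complex Lie algebras\<close>

class complex_vector_space = ab_group_add +
  fixes scaleC :: "complex \<Rightarrow> 'a \<Rightarrow> 'a" (infixr "*\<^sub>C" 75)
  assumes scaleC_right_distrib: "a *\<^sub>C (x + y) = a *\<^sub>C x + a *\<^sub>C y"
    and scaleC_left_distrib: "(a + b) *\<^sub>C x = a *\<^sub>C x + b *\<^sub>C x"
    and scaleC_scaleC: "a *\<^sub>C (b *\<^sub>C x) = (a * b) *\<^sub>C x"
    and scaleC_one: "1 *\<^sub>C x = x"

global_interpretation cvec: vector_space "scaleC :: complex \<Rightarrow> 'a \<Rightarrow> 'a::complex_vector_space"
  by unfold_locales
    (simp_all add: scaleC_right_distrib scaleC_left_distrib scaleC_scaleC scaleC_one)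

class complex_lie_algebra = complex_vector_space +
  fixes bracket :: "'a \<Rightarrow> 'a \<Rightarrow> 'a"
  assumes bracket_add_left: "bracket (x + y) z = bracket x z + bracket y z"
    and bracket_add_right: "bracket x (y + z) = bracket x y + bracket x z"
    and bracket_scale_left: "bracket (c *\<^sub>C x) y = c *\<^sub>C bracket x y"
    and bracket_scale_right: "bracket x (c *\<^sub>C y) = c *\<^sub>C bracket x y"
    and bracket_self: "bracket x x = 0"
    and jacobi: "bracket x (bracket y z) + bracket y (bracket z x) + bracket z (bracket x y) = 0"

text \<open>The trace of a linear endomorphism of a finite-dimensional space, computed in some basis
  (it does not depend on which one).\<close>

definition endo_trace :: "('a::complex_vector_space \<Rightarrow> 'a) \<Rightarrow> complex" where
  "endo_trace f =
    (let B = (SOME B. cvec.independent B \<and> cvec.span B = UNIV)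
     in \<Sum>b\<in>B. cvec.representation B (f b) b)"

definition killing :: "'g::complex_lie_algebra \<Rightarrow> 'g \<Rightarrow> complex" where
  "killing X Y = endo_trace (\<lambda>Z. bracket X (bracket Y Z))"


section \<open>The symplectic Lie algebra\<close>

text \<open>The index type \<^typ>\<open>'n + 'n\<close> has \<open>2n\<close> elements for \<open>n = CARD('n)\<close>. A matrix \<open>A\<close>
  preserves the form infinitesimally: \<open>\<omega>(Ax, y) + \<omega>(x, Ay) = 0\<close>.\<close>

definition symp_form :: "complex ^ ('n::finite + 'n) \<Rightarrow> complex ^ ('n + 'n) \<Rightarrow> complex" where
  "symp_form x y = (\<Sum>i\<in>UNIV. x $ Inl i * y $ Inr i - x $ Inr i * y $ Inl i)"

lemma symp_form_skew: "symp_form y x = - symp_form x y"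
  by (simp add: symp_form_def flip: sum_negf) (simp add: algebra_simps)

lemma symp_form_nondegenerate:
  assumes "\<And>y. symp_form x y = 0"
  shows "x = 0"
proof -
  have l: "x $ Inl k = 0" for k
    using assms[of "axis (Inr k) 1"]
    by (simp add: symp_form_def axis_def if_distrib[of "(*) _"] cong: if_cong)
  have r: "x $ Inr k = 0" for k
    using assms[of "axis (Inl k) 1"]
    by (simp add: symp_form_def axis_def if_distrib[of "(*) _"] sum_negf cong: if_cong)
  show ?thesis
    unfolding vec_eq_iff
  proof
    fix i
    show "x $ i = 0 $ i"
      by (cases i) (simp_all add: l r)
  qed
qed

lemma symp_form_add_left: "symp_form (x + y) z = symp_form x z + symp_form y z"
  by (simp add: symp_form_def algebra_simps flip: sum.distrib)

lemma symp_form_add_right: "symp_form x (y + z) = symp_form x y + symp_form x z"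
  by (simp add: symp_form_def algebra_simps flip: sum.distrib)

lemma symp_form_scale_left: "symp_form (c *s x) y = c * symp_form x y"
  by (simp add: symp_form_def algebra_simps sum_distrib_left)

lemma symp_form_scale_right: "symp_form x (c *s y) = c * symp_form x y"
  by (simp add: symp_form_def algebra_simps sum_distrib_left)

lemma symp_form_zero [simp]: "symp_form 0 y = 0" "symp_form x 0 = 0"
  by (simp_all add: symp_form_def)

lemma symp_form_minus [simp]: "symp_form (- x) y = - symp_form x y" "symp_form x (- y) = - symp_form x y"
  using symp_form_scale_left[of "-1" x y] symp_form_scale_right[of x "-1" y] by simp_all

definition symplectic :: "complex ^ ('n::finite + 'n) ^ ('n + 'n) \<Rightarrow> bool" where
  "symplectic A \<longleftrightarrow> (\<forall>x y. symp_form (A *v x) y + symp_form x (A *v y) = 0)"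

lemma map_matrix_mult_vec: "map_matrix ((*) c) A *v x = c *s (A *v x)"
  for c :: complex
  by (simp add: vec_eq_iff matrix_vector_mult_def sum_distrib_left algebra_simps)

lemma matrix_minus_vec: "(- A) *v x = - (A *v x)" for A :: "complex ^ 'm ^ 'k"
  using matrix_vector_mult_diff_rdistrib[of 0 A x] by simp

lemma symp_form_diff_left: "symp_form (x - y) z = symp_form x z - symp_form y z"
  using symp_form_add_left[of x "- y" z] by simp

lemma symp_form_diff_right: "symp_form x (y - z) = symp_form x y - symp_form x z"
  using symp_form_add_right[of x y "- z"] by simp

lemma symplectic_iff: "symplectic A \<longleftrightarrow> (\<forall>x y. symp_form (A *v x) y = - symp_form x (A *v y))"
  by (simp add: symplectic_def eq_neg_iff_add_eq_0)

lemma symplectic_commutator: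
  assumes "symplectic A" "symplectic B"
  shows "symplectic (A ** B - B ** A)"
  using assms unfolding symplectic_iff
  by (simp add: matrix_vector_mult_diff_rdistrib symp_form_diff_left symp_form_diff_right
      flip: matrix_vector_mul_assoc)

lemma matrix_distribs:
  fixes A B C :: "complex ^ 'm ^ 'm"
  shows "A ** (B + C) = A ** B + A ** C" "(A + B) ** C = A ** C + B ** C"
    "A ** (B - C) = A ** B - A ** C" "(A - B) ** C = A ** C - B ** C"
  by (simp_all add: vec_eq_iff matrix_matrix_mult_def algebra_simps sum.distrib sum_subtractf)

typedef 'n sp = "{A :: complex ^ ('n::finite + 'n) ^ ('n + 'n). symplectic A}"
  morphisms matrix_of_sp sp_of_matrix
  by (rule exI[of _ 0]) (simp add: symplectic_def)

setup_lifting type_definition_sp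

instantiation sp :: (finite) complex_lie_algebra
begin

lift_definition zero_sp :: "'a sp" is 0
  by (simp add: symplectic_def)

lift_definition plus_sp :: "'a sp \<Rightarrow> 'a sp \<Rightarrow> 'a sp" is "(+)"
  by (simp add: symplectic_iff matrix_vector_mult_add_rdistrib symp_form_add_left symp_form_add_right)

lift_definition uminus_sp :: "'a sp \<Rightarrow> 'a sp" is uminus
  by (simp add: symplectic_iff matrix_minus_vec)

lift_definition minus_sp :: "'a sp \<Rightarrow> 'a sp \<Rightarrow> 'a sp" is "\<lambda>A B. A - B"
  by (simp add: symplectic_iff matrix_vector_mult_diff_rdistrib symp_form_diff_left symp_form_diff_right)

lift_definition scaleC_sp :: "complex \<Rightarrow> 'a sp \<Rightarrow> 'a sp" is "\<lambda>c. map_matrix ((*) c)"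
  by (simp add: symplectic_iff map_matrix_mult_vec symp_form_scale_left symp_form_scale_right)

lift_definition bracket_sp :: "'a sp \<Rightarrow> 'a sp \<Rightarrow> 'a sp" is "\<lambda>A B. A ** B - B ** A"
  by (rule symplectic_commutator)

instance
proof
  fix a b c :: "'a sp" and r s :: complex
  show "a + b + c = a + (b + c)" by transfer simp
  show "a + b = b + a" by transfer simp
  show "0 + a = a" by transfer simp
  show "- a + a = 0" by transfer simp
  show "a - b = a + - b" by transfer simp
  show "r *\<^sub>C (a + b) = r *\<^sub>C a + r *\<^sub>C b"
    by transfer (simp add: vec_eq_iff algebra_simps)
  show "(r + s) *\<^sub>C a = r *\<^sub>C a + s *\<^sub>C a"
    by transfer (simp add: vec_eq_iff algebra_simps)
  show "r *\<^sub>C s *\<^sub>C a = (r * s) *\<^sub>C a"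
    by transfer (simp add: vec_eq_iff algebra_simps)
  show "1 *\<^sub>C a = a"
    by transfer (simp add: vec_eq_iff)
  show "bracket (a + b) c = bracket a c + bracket b c"
    by transfer (simp add: matrix_distribs)
  show "bracket a (b + c) = bracket a b + bracket a c"
    by transfer (simp add: matrix_distribs)
  show "bracket (r *\<^sub>C a) b = r *\<^sub>C bracket a b"
    by transfer (simp add: vec_eq_iff matrix_matrix_mult_def sum_distrib_left algebra_simps)
  show "bracket a (r *\<^sub>C b) = r *\<^sub>C bracket a b"
    by transfer (simp add: vec_eq_iff matrix_matrix_mult_def sum_distrib_left algebra_simps)
  show "bracket a a = 0" by transfer simp
  show "bracket a (bracket b c) + bracket b (bracket c a) + bracket c (bracket a b) = 0"
  proof transfer
    fix a b c :: "complex ^ ('a + 'a) ^ ('a + 'a)"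
    show "a ** (b ** c - c ** b) - (b ** c - c ** b) ** a
        + (b ** (c ** a - a ** c) - (c ** a - a ** c) ** b)
        + (c ** (a ** b - b ** a) - (a ** b - b ** a) ** c) = 0"
      by (simp add: matrix_distribs matrix_mul_assoc)
  qed
qed

end


section \<open>Two-sided ideals\<close>

definition two_sided_ideal :: "'r::ring_1 set \<Rightarrow> bool" where
  "two_sided_ideal I \<longleftrightarrow>
    0 \<in> I \<and> (\<forall>x\<in>I. \<forall>y\<in>I. x + y \<in> I) \<and> (\<forall>x\<in>I. \<forall>r. r * x \<in> I \<and> x * r \<in> I)"

definition ideal_generated :: "'r::ring_1 set \<Rightarrow> 'r set" where
  "ideal_generated S = \<Inter>{I. two_sided_ideal I \<and> S \<subseteq> I}"

lemma two_sided_ideal_generated: "two_sided_ideal (ideal_generated S)"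
  unfolding two_sided_ideal_def ideal_generated_def by blast

lemma ideal_generated_incl: "x \<in> S \<Longrightarrow> x \<in> ideal_generated S"
  unfolding ideal_generated_def by blast

lemma ideal_generated_minimal: "two_sided_ideal I \<Longrightarrow> S \<subseteq> I \<Longrightarrow> ideal_generated S \<subseteq> I"
  unfolding ideal_generated_def by blast

lemma ideal_zero: "two_sided_ideal I \<Longrightarrow> 0 \<in> I"
  and ideal_add: "two_sided_ideal I \<Longrightarrow> x \<in> I \<Longrightarrow> y \<in> I \<Longrightarrow> x + y \<in> I"
  and ideal_mult_left: "two_sided_ideal I \<Longrightarrow> x \<in> I \<Longrightarrow> r * x \<in> I"
  and ideal_mult_right: "two_sided_ideal I \<Longrightarrow> x \<in> I \<Longrightarrow> x * r \<in> I"
  by (simp_all add: two_sided_ideal_def)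

lemma ideal_uminus: "two_sided_ideal I \<Longrightarrow> x \<in> I \<Longrightarrow> - x \<in> I"
  using ideal_mult_left[of I x "- 1"] by simp

lemma ideal_diff: "two_sided_ideal I \<Longrightarrow> x \<in> I \<Longrightarrow> y \<in> I \<Longrightarrow> x - y \<in> I"
  using ideal_add[of I x "- y"] ideal_uminus[of I y] by simp


section \<open>The tensor algebra of a complex vector space\<close>

text \<open>The tensor algebra of \<open>V\<close> is the free unital associative algebra on the set \<open>V\<close> (finitely
  supported complex functions on words in \<open>V\<close>, with the convolution product) modulo the two-sided
  ideal that makes the generators depend linearly on \<open>V\<close>. Words are a separate type
  because the convolution product of \<^theory>\<open>HOL-Library.Poly_Mapping\<close> is indexed by an
  additively written monoid.\<close>

datatype 'a word = Word (letters: "'a list")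

instantiation word :: (type) monoid_add
begin

definition zero_word :: "'a word" where "zero_word = Word []"

definition plus_word :: "'a word \<Rightarrow> 'a word \<Rightarrow> 'a word" where
  "plus_word u v = Word (letters u @ letters v)"

instance
  by standard (simp_all add: zero_word_def plus_word_def)

end

type_synonym 'a free_algebra = "'a word \<Rightarrow>\<^sub>0 complex"

definition free_gen :: "'a \<Rightarrow> 'a free_algebra" where
  "free_gen x = Poly_Mapping.single (Word [x]) 1"

definition free_const :: "complex \<Rightarrow> 'a free_algebra" where
  "free_const c = Poly_Mapping.single 0 c"

definition linearity_relations :: "'a::complex_vector_space free_algebra set" where
  "linearity_relations =
    {free_gen (x + y) - free_gen x - free_gen y | x y. True} \<union>
    {free_gen (c *\<^sub>C x) - free_const c * free_gen x | c x. True}"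

definition linearity_ideal :: "'a::complex_vector_space free_algebra set" where
  "linearity_ideal = ideal_generated linearity_relations"

definition tensor_rel :: "'a::complex_vector_space free_algebra \<Rightarrow> 'a free_algebra \<Rightarrow> bool" where
  "tensor_rel p q \<longleftrightarrow> p - q \<in> linearity_ideal"

lemma two_sided_linearity_ideal: "two_sided_ideal linearity_ideal"
  by (simp add: linearity_ideal_def two_sided_ideal_generated)

lemmas linearity_ideal_closed =
  ideal_zero[OF two_sided_linearity_ideal] ideal_add[OF two_sided_linearity_ideal]
  ideal_mult_left[OF two_sided_linearity_ideal] ideal_mult_right[OF two_sided_linearity_ideal]
  ideal_uminus[OF two_sided_linearity_ideal] ideal_diff[OF two_sided_linearity_ideal]

lemma equivp_tensor_rel: "equivp tensor_rel"
proof (rule equivpI)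
  show "reflp tensor_rel"
    by (simp add: reflp_def tensor_rel_def linearity_ideal_closed)
  show "symp tensor_rel"
    unfolding symp_def tensor_rel_def using linearity_ideal_closed(5) by fastforce
  show "transp tensor_rel"
    unfolding transp_def tensor_rel_def using linearity_ideal_closed(2) by fastforce
qed

quotient_type (overloaded) 'a tensor_algebra = "'a::complex_vector_space free_algebra" / tensor_rel
  by (rule equivp_tensor_rel)

lemma word_zero_eq_plus_iff: "(0 :: 'a word) = u + v \<longleftrightarrow> u = 0 \<and> v = 0"
  by (cases u; cases v) (auto simp: zero_word_def plus_word_def)

lemma lookup_free_mult_zero:
  "Poly_Mapping.lookup (p * q :: 'a free_algebra) 0 = Poly_Mapping.lookup p 0 * Poly_Mapping.lookup q 0"
proof -
  have "(Poly_Mapping.lookup q v when (0 :: 'a word) = u + v)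
      = ((Poly_Mapping.lookup q v when u = 0) when v = 0)" for u v
    by (simp add: word_zero_eq_plus_iff when_def)
  then show ?thesis
    by (simp add: lookup_mult mult_when)
qed

lemma one_notin_linearity_ideal: "1 \<notin> (linearity_ideal :: 'a::complex_vector_space free_algebra set)"
proof -
  let ?K = "{p :: 'a free_algebra. Poly_Mapping.lookup p 0 = 0}"
  have "two_sided_ideal ?K"
    by (simp add: two_sided_ideal_def lookup_add lookup_free_mult_zero)
  moreover have "Poly_Mapping.lookup (free_gen x) 0 = 0" for x :: 'a
    by (simp add: free_gen_def lookup_single zero_word_def when_def)
  then have "linearity_relations \<subseteq> ?K"
    by (auto simp: linearity_relations_def lookup_minus lookup_free_mult_zero)
  ultimately have "linearity_ideal \<subseteq> ?K"
    unfolding linearity_ideal_def by (rule ideal_generated_minimal)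
  then show ?thesis
    by (auto simp: lookup_one)
qed

instantiation tensor_algebra :: (complex_vector_space) "{ring_1, complex_vector_space}"
begin

lift_definition zero_tensor_algebra :: "'a tensor_algebra" is 0 .

lift_definition one_tensor_algebra :: "'a tensor_algebra" is 1 .

lift_definition plus_tensor_algebra :: "'a tensor_algebra \<Rightarrow> 'a tensor_algebra \<Rightarrow> 'a tensor_algebra"
  is "(+)"
  unfolding tensor_rel_def add_diff_add by (rule linearity_ideal_closed(2))

lift_definition uminus_tensor_algebra :: "'a tensor_algebra \<Rightarrow> 'a tensor_algebra" is uminus
  unfolding tensor_rel_def minus_diff_minus by (rule linearity_ideal_closed(5))

lift_definition minus_tensor_algebra :: "'a tensor_algebra \<Rightarrow> 'a tensor_algebra \<Rightarrow> 'a tensor_algebra"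
  is "\<lambda>p q. p - q"
proof -
  fix p p' q q' :: "'a free_algebra"
  assume "tensor_rel p p'" "tensor_rel q q'"
  moreover have "p - q - (p' - q') = (p - p') - (q - q')"
    by simp
  ultimately show "tensor_rel (p - q) (p' - q')"
    by (simp only: tensor_rel_def linearity_ideal_closed)
qed

lift_definition times_tensor_algebra :: "'a tensor_algebra \<Rightarrow> 'a tensor_algebra \<Rightarrow> 'a tensor_algebra"
  is "(*)"
proof -
  fix p p' q q' :: "'a free_algebra"
  assume "tensor_rel p p'" "tensor_rel q q'"
  moreover have "p * q - p' * q' = (p - p') * q + p' * (q - q')"
    by (simp add: algebra_simps)
  ultimately show "tensor_rel (p * q) (p' * q')"
    by (simp only: tensor_rel_def linearity_ideal_closed)
qed

lift_definition scaleC_tensor_algebra :: "complex \<Rightarrow> 'a tensor_algebra \<Rightarrow> 'a tensor_algebra"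
  is "\<lambda>c p. free_const c * p"
  by (simp add: tensor_rel_def linearity_ideal_closed flip: right_diff_distrib)

instance
proof
  have refl: "tensor_rel p p" for p :: "'a free_algebra"
    using equivp_tensor_rel by (rule equivp_reflp)
  fix a b c :: "'a tensor_algebra" and r s :: complex
  show "a + b + c = a + (b + c)" by transfer (simp add: add.assoc refl)
  show "a + b = b + a" by transfer (simp add: add.commute refl)
  show "0 + a = a" by transfer (simp add: refl)
  show "- a + a = 0" by transfer (simp add: refl)
  show "a - b = a + - b" by transfer (simp add: refl)
  show "a * b * c = a * (b * c)" by transfer (simp add: mult.assoc refl)
  show "1 * a = a" by transfer (simp add: refl)
  show "a * 1 = a" by transfer (simp add: refl)
  show "(a + b) * c = a * c + b * c" by transfer (simp add: distrib_right refl)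
  show "a * (b + c) = a * b + a * c" by transfer (simp add: distrib_left refl)
  show "(0 :: 'a tensor_algebra) \<noteq> 1"
    by transfer
      (use linearity_ideal_closed(5)[of "- 1"] one_notin_linearity_ideal in \<open>auto simp: tensor_rel_def\<close>)
  show "r *\<^sub>C (a + b) = r *\<^sub>C a + r *\<^sub>C b" by transfer (simp add: distrib_left refl)
  show "(r + s) *\<^sub>C a = r *\<^sub>C a + s *\<^sub>C a"
    by transfer (simp add: free_const_def single_add distrib_right refl)
  show "r *\<^sub>C s *\<^sub>C a = (r * s) *\<^sub>C a"
    by transfer (simp add: free_const_def mult_single refl flip: mult.assoc)
  show "1 *\<^sub>C a = a" by transfer (simp add: free_const_def refl)
qed

end

lift_definition tensor_gen :: "'a::complex_vector_space \<Rightarrow> 'a tensor_algebra" is free_gen .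

definition tensor_power :: "nat \<Rightarrow> 'a::complex_vector_space tensor_algebra set" where
  "tensor_power s = cvec.span {prod_list (map tensor_gen xs) | xs. length xs = s}"


section \<open>The action of a Lie algebra on its tensor algebra\<close>

text \<open>\<open>Z\<close> acts by the derivation that extends \<open>X \<mapsto> [Z, X]\<close>.\<close>

primrec word_action :: "'g::complex_lie_algebra \<Rightarrow> 'g list \<Rightarrow> 'g free_algebra" where
  "word_action Z [] = 0"
| "word_action Z (X # Xs) =
    free_gen (bracket Z X) * Poly_Mapping.single (Word Xs) 1 + free_gen X * word_action Z Xs"

definition free_action :: "'g::complex_lie_algebra \<Rightarrow> 'g free_algebra \<Rightarrow> 'g free_algebra" where
  "free_action Z p =
    (\<Sum>w\<in>Poly_Mapping.keys p. free_const (Poly_Mapping.lookup p w) * word_action Z (letters w))"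

lemma free_action_superset:
  assumes "finite A" "Poly_Mapping.keys p \<subseteq> A"
  shows "free_action Z p =
    (\<Sum>w\<in>A. free_const (Poly_Mapping.lookup p w) * word_action Z (letters w))"
  unfolding free_action_def
  by (rule sum.mono_neutral_left) (use assms in \<open>auto simp: in_keys_iff free_const_def\<close>)

lemma free_action_add: "free_action Z (p + q) = free_action Z p + free_action Z q"
proof -
  let ?A = "Poly_Mapping.keys p \<union> Poly_Mapping.keys q"
  have "free_action Z (p + q) =
      (\<Sum>w\<in>?A. free_const (Poly_Mapping.lookup (p + q) w) * word_action Z (letters w))"
    by (rule free_action_superset) (simp_all add: keys_add)
  also have "\<dots> = free_action Z p + free_action Z q"
    by (simp add: free_action_superset[of ?A p] free_action_superset[of ?A q] lookup_add
        free_const_def single_add distrib_right sum.distrib)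
  finally show ?thesis .
qed

lemma free_action_single:
  "free_action Z (Poly_Mapping.single w c) = free_const c * word_action Z (letters w)"
  by (subst free_action_superset[of "{w}"]) simp_all

lemma free_action_zero [simp]: "free_action Z 0 = 0"
  by (simp add: free_action_def)

lemma free_action_uminus: "free_action Z (- p) = - free_action Z p"
  using free_action_add[of Z p "- p"] by (simp add: eq_neg_iff_add_eq_0 add.commute)

lemma free_action_diff: "free_action Z (p - q) = free_action Z p - free_action Z q"
  using free_action_add[of Z p "- q"] by (simp add: free_action_uminus)

lemma word_action_append:
  "word_action Z (xs @ ys) =
    word_action Z xs * Poly_Mapping.single (Word ys) 1 + Poly_Mapping.single (Word xs) 1 * word_action Z ys"
  by (induction xs)
    (simp_all add: algebra_simps free_gen_def mult_single plus_word_def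
      flip: mult.assoc zero_word_def)

lemma free_algebra_sum_singles:
  "(p :: 'a free_algebra) = (\<Sum>w\<in>Poly_Mapping.keys p. Poly_Mapping.single w (Poly_Mapping.lookup p w))"
proof (rule poly_mapping_eqI)
  fix k
  have "(\<Sum>w\<in>Poly_Mapping.keys p. Poly_Mapping.lookup p w when w = k) =
      (if k \<in> Poly_Mapping.keys p then Poly_Mapping.lookup p k else 0)"
    by (simp add: when_def)
  then show "Poly_Mapping.lookup p k =
      Poly_Mapping.lookup (\<Sum>w\<in>Poly_Mapping.keys p. Poly_Mapping.single w (Poly_Mapping.lookup p w)) k"
    by (simp add: lookup_sum lookup_single in_keys_iff)
qed

lemma free_algebra_induct [case_names zero single add]:
  fixes p :: "'a free_algebra"
  assumes "P 0" "\<And>w c. P (Poly_Mapping.single w c)" "\<And>p q. P p \<Longrightarrow> P q \<Longrightarrow> P (p + q)"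
  shows "P p"
proof -
  have "P (\<Sum>w\<in>A. Poly_Mapping.single w (f w))" if "finite A" for A and f :: "'a word \<Rightarrow> complex"
    using that by induction (simp_all add: assms)
  then show ?thesis
    by (subst free_algebra_sum_singles) simp
qed

lemma free_const_commute: "free_const c * p = p * free_const c"
  by (induction p rule: free_algebra_induct)
    (simp_all add: free_const_def mult_single mult.commute algebra_simps)

lemma free_action_mult: "free_action Z (p * q) = free_action Z p * q + p * free_action Z q"
proof (induction p rule: free_algebra_induct)
  case (single u a)
  show ?case
  proof (induction q rule: free_algebra_induct)
    case (single v b)
    have u: "Poly_Mapping.single u a = free_const a * Poly_Mapping.single u 1"
      by (simp add: free_const_def mult_single)
    have v: "Poly_Mapping.single v b = free_const b * Poly_Mapping.single v 1"
      by (simp add: free_const_def mult_single)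
    have ab: "free_const (a * b) = free_const a * free_const b"
      by (simp add: free_const_def mult_single)
    have "free_action Z (Poly_Mapping.single u a * Poly_Mapping.single v b) =
        free_const (a * b) * word_action Z (letters u @ letters v)"
      by (simp add: mult_single free_action_single plus_word_def)
    also have "\<dots> = free_const a * (free_const b * word_action Z (letters u)) * Poly_Mapping.single v 1
        + free_const a * (free_const b * Poly_Mapping.single u 1) * word_action Z (letters v)"
      by (simp add: word_action_append ab distrib_left mult.assoc)
    also have "\<dots> = free_action Z (Poly_Mapping.single u a) * Poly_Mapping.single v b
        + Poly_Mapping.single u a * free_action Z (Poly_Mapping.single v b)"
      unfolding free_action_single free_const_commute[of b "word_action Z (letters u)"]
        free_const_commute[of b "Poly_Mapping.single u 1"]
      by (simp add: u v mult.assoc)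
    finally show ?case .
  qed (simp_all add: free_action_add algebra_simps)
qed (simp_all add: free_action_add algebra_simps)

lemma free_action_gen [simp]: "free_action Z (free_gen X) = free_gen (bracket Z X)"
  by (simp add: free_gen_def free_action_single free_const_def flip: zero_word_def)

lemma free_action_const [simp]: "free_action Z (free_const c) = 0"
  by (simp add: free_const_def free_action_single zero_word_def)

lemma free_action_linearity_ideal:
  assumes "p \<in> linearity_ideal"
  shows "free_action Z p \<in> linearity_ideal"
proof -
  let ?I = "linearity_ideal :: 'a free_algebra set"
  let ?K = "{p \<in> ?I. free_action Z p \<in> ?I}"
  have "two_sided_ideal ?K"
    by (auto simp: two_sided_ideal_def free_action_add free_action_mult linearity_ideal_closed)
  moreover have "linearity_relations \<subseteq> ?K"
  proof
    fix p :: "'a free_algebra"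
    assume p: "p \<in> linearity_relations"
    then have "free_action Z p \<in> linearity_relations"
      unfolding linearity_relations_def Un_iff mem_Collect_eq
      by (elim disjE exE conjE)
        (simp_all add: free_action_diff free_action_mult bracket_add_right bracket_scale_right,
          blast+)
    with p show "p \<in> ?K"
      by (simp add: linearity_ideal_def ideal_generated_incl)
  qed
  ultimately have "?I \<subseteq> ?K"
    unfolding linearity_ideal_def[where 'a = 'a] by (rule ideal_generated_minimal)
  with assms show ?thesis by blast
qed

lift_definition tensor_action ::
    "'g::complex_lie_algebra \<Rightarrow> 'g tensor_algebra \<Rightarrow> 'g tensor_algebra" is free_action
  by (simp add: tensor_rel_def free_action_linearity_ideal flip: free_action_diff)

lemma tensor_action_gen: "tensor_action Z (tensor_gen X) = tensor_gen (bracket Z X)"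
  by transfer (simp add: equivp_reflp[OF equivp_tensor_rel])

lemma tensor_action_mult: "tensor_action Z (s * t) = tensor_action Z s * t + s * tensor_action Z t"
  by transfer (simp add: free_action_mult equivp_reflp[OF equivp_tensor_rel])


section \<open>Weights\<close>

text \<open>For semisimple \<open>\<gg>\<close>: an abelian, self-centralizing subalgebra all of whose elements are
  \<open>ad\<close>-diagonalizable.\<close>

definition cartan_subalgebra :: "'g::complex_lie_algebra set \<Rightarrow> bool" where
  "cartan_subalgebra h \<longleftrightarrow>
    cvec.subspace h \<and>
    (\<forall>H\<in>h. \<forall>K\<in>h. bracket H K = 0) \<and>
    (\<forall>X. (\<forall>H\<in>h. bracket H X = 0) \<longrightarrow> X \<in> h) \<and>
    (\<forall>H\<in>h. cvec.span {X. \<exists>c. bracket H X = c *\<^sub>C X} = UNIV)"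

text \<open>Below, \<open>\<rho> :: 'g \<Rightarrow> 'v \<Rightarrow> 'v\<close> is the action of \<open>\<gg>\<close> on a module; a weight is given by its
  values on \<open>h\<close>.\<close>

definition weight_space ::
    "'g::complex_lie_algebra set \<Rightarrow> ('g \<Rightarrow> 'v::complex_vector_space \<Rightarrow> 'v) \<Rightarrow> ('g \<Rightarrow> complex) \<Rightarrow> 'v set"
  where "weight_space h \<rho> \<mu> = {v. \<forall>H\<in>h. \<rho> H v = \<mu> H *\<^sub>C v}"

text \<open>Roots are normalized to vanish off \<open>h\<close>, so that equality of roots is equality on \<open>h\<close>.
  Linearity on \<open>h\<close> is automatic, as the root space is nonzero.\<close>

definition roots :: "'g::complex_lie_algebra set \<Rightarrow> ('g \<Rightarrow> complex) set" where
  "roots h = {\<alpha>. (\<forall>X. X \<notin> h \<longrightarrow> \<alpha> X = 0) \<and> (\<exists>H\<in>h. \<alpha> H \<noteq> 0) \<and>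
                  (\<exists>X\<in>weight_space h bracket \<alpha>. X \<noteq> 0)}"

definition positive_system :: "'g::complex_lie_algebra set \<Rightarrow> ('g \<Rightarrow> complex) set \<Rightarrow> bool" where
  "positive_system h \<Phi> \<longleftrightarrow>
    \<Phi> \<subseteq> roots h \<and>
    (\<forall>\<alpha>\<in>roots h. \<alpha> \<in> \<Phi> \<longleftrightarrow> (\<lambda>H. - \<alpha> H) \<notin> \<Phi>) \<and>
    (\<forall>\<alpha>\<in>\<Phi>. \<forall>\<beta>\<in>\<Phi>. (\<lambda>H. \<alpha> H + \<beta> H) \<in> roots h \<longrightarrow> (\<lambda>H. \<alpha> H + \<beta> H) \<in> \<Phi>)"

definition submodule ::
    "('g::complex_lie_algebra \<Rightarrow> 'v::complex_vector_space \<Rightarrow> 'v) \<Rightarrow> 'v set \<Rightarrow> bool" where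
  "submodule \<rho> W \<longleftrightarrow> cvec.subspace W \<and> (\<forall>Z. \<forall>w\<in>W. \<rho> Z w \<in> W)"

definition irreducible_submodule ::
    "('g::complex_lie_algebra \<Rightarrow> 'v::complex_vector_space \<Rightarrow> 'v) \<Rightarrow> 'v set \<Rightarrow> bool" where
  "irreducible_submodule \<rho> W \<longleftrightarrow>
    submodule \<rho> W \<and> W \<noteq> {0} \<and> (\<forall>U\<subseteq>W. submodule \<rho> U \<longrightarrow> U = {0} \<or> U = W)"

definition has_highest_weight ::
    "'g::complex_lie_algebra set \<Rightarrow> ('g \<Rightarrow> complex) set \<Rightarrow>
     ('g \<Rightarrow> 'v::complex_vector_space \<Rightarrow> 'v) \<Rightarrow> 'v set \<Rightarrow> ('g \<Rightarrow> complex) \<Rightarrow> bool" where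
  "has_highest_weight h \<Phi> \<rho> W \<mu> \<longleftrightarrow>
    (\<exists>w\<in>W. w \<noteq> 0 \<and> w \<in> weight_space h \<rho> \<mu> \<and>
      (\<forall>\<alpha>\<in>\<Phi>. \<forall>E\<in>weight_space h bracket \<alpha>. \<rho> E w = 0))"


section \<open>The Cartan product\<close>

text \<open>\<open>W\<close> is the irreducible component of \<open>\<gg> \<otimes> \<gg>\<close> whose highest weight is twice that of the
  adjoint representation, for some choice of Cartan subalgebra and positive roots (for simple
  \<open>\<gg>\<close> all choices give the same \<open>W\<close>).\<close>

definition cartan_square :: "'g::complex_lie_algebra tensor_algebra set \<Rightarrow> bool" where
  "cartan_square W \<longleftrightarrow>
    W \<subseteq> tensor_power 2 \<and> irreducible_submodule tensor_action W \<and>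
    (\<exists>h \<Phi> \<theta>. cartan_subalgebra h \<and> positive_system h \<Phi> \<and>
      has_highest_weight h \<Phi> bracket UNIV \<theta> \<and>
      has_highest_weight h \<Phi> tensor_action W (\<lambda>H. 2 * \<theta> H))"

text \<open>\<open>P\<close> restricts to an invariant projection of \<open>\<gg> \<otimes> \<gg>\<close> onto the Cartan product; only its
  values on \<open>\<gg> \<otimes> \<gg>\<close> matter, and they are uniquely determined for simple \<open>\<gg>\<close>.\<close>

definition cartan_projection ::
    "('g::complex_lie_algebra tensor_algebra \<Rightarrow> 'g tensor_algebra) \<Rightarrow> bool" where
  "cartan_projection P \<longleftrightarrow>
    (\<forall>s\<in>tensor_power 2. \<forall>t\<in>tensor_power 2. P (s + t) = P s + P t) \<and>
    (\<forall>c. \<forall>t\<in>tensor_power 2. P (c *\<^sub>C t) = c *\<^sub>C P t) \<and>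
    (\<forall>Z. \<forall>t\<in>tensor_power 2. P (tensor_action Z t) = tensor_action Z (P t)) \<and>
    (\<exists>W. cartan_square W \<and> P ` tensor_power 2 = W \<and> (\<forall>w\<in>W. P w = w))"

end

theory Submission
  imports Defs "HOL-Computational_Algebra.Fundamental_Theorem_Algebra"
begin

text \<open>
  Write \<open>V\<close> for the defining representation, \<open>\<omega>\<close> for the symplectic form and \<open>ab\<close> for the element
  \<open>v \<mapsto> \<omega>(a,v) b + \<omega>(b,v) a\<close> of \<open>\<gg>\<close>. These elements identify \<open>\<gg>\<close> with the symmetric square of \<open>V\<close>,
  and the Cartan product is the copy of the fourth symmetric power of \<open>V\<close> in \<open>\<gg> \<otimes> \<gg>\<close>. Hence
  \<open>ab \<circledcirc> cd\<close> depends symmetrically on \<open>a, b, c, d\<close>; this (\<open>projection_symmetric\<close>) is all that is used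
  of the Cartan product, besides its equivariance.

  In the quotient by the ideal, two products such as \<open>(xx)(zz)\<close> and \<open>(xz)(xz)\<close> thus differ only by
  brackets and multiples of the Killing form. Take \<open>x, y, z\<close> with \<open>\<omega>(x,y) = 1\<close> and \<open>z\<close> orthogonal to both.
  Then \<open>p = xz\<close> and \<open>q = yz\<close> satisfy \<open>pq - qp = zz\<close> with \<open>zz\<close> commuting with everything in sight, and
  \<open>(xx)(zz) = p\<^sup>2\<close>, \<open>(yy)(zz) = q\<^sup>2\<close>, \<open>2(xy)(zz) = pq + qp\<close>: up to inverting \<open>zz\<close> this is the oscillator
  representation of \<open>\<ss>\<ll>\<^sub>2\<close>. There the Casimir element \<open>(xx)(yy) + (yy)(xx) - 2(xy)\<^sup>2\<close> has a fixed value,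
  whereas the relations give it a value proportional to \<open>\<lambda>\<close>. The two agree only for the excluded \<open>\<lambda>\<close>, so
  otherwise \<open>(zz)\<^sup>2\<close> vanishes (\<open>oscillator_casimir\<close>, \<open>casimir_times_square\<close>). By equivariance the whole
  Cartan product vanishes with it, so that every product of generators becomes half a bracket plus a multiple
  of the Killing form. For a second hyperbolic pair \<open>z, t\<close>, the elements \<open>xy\<close> and \<open>zt\<close> then have product
  \<open>0\<close>, although each multiplies \<open>xz\<close> by \<open>-1/2\<close>. So \<open>xz = 0\<close>, and with it all of \<open>\<gg>\<close> vanishes.

  The remaining work is to identify the Cartan product, which is given only through some Cartan subalgebra and
  some positive system. The weights of a Cartan subalgebra on \<open>V\<close> show that twice the highest root of \<open>\<gg>\<close> has
  weight vector \<open>bb \<otimes> bb\<close> for some \<open>b\<close> (\<open>highest_root_is_long\<close>), and irreducibility puts the Cartan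
  product into the span of the totally symmetrized tensors. An equivariant map from \<open>\<gg> \<otimes> \<gg>\<close> into that span
  is determined by its value on \<open>xx \<otimes> yy\<close>, and invariance leaves only one possible value up to a scalar
  (\<open>projection_eq_quartic\<close>).
\<close>


section \<open>Eigenvectors\<close>

text \<open>Applying \<open>T - f i\<close> to \<open>q\<close> removes \<open>m i\<close> from the spanning family and only multiplies \<open>q\<close> by
  \<open>c - f i \<noteq> 0\<close>, so the family can be emptied one member at a time.\<close>

lemma (in vector_space) eigenvector_in_span_of_others:
  assumes T: "\<And>x y. T (x + y) = T x + T y" "\<And>a x. T (scale a x) = scale a (T x)"
    and "finite F" "\<And>i. i \<in> F \<Longrightarrow> T (m i) = scale (f i) (m i)" "\<And>i. i \<in> F \<Longrightarrow> f i \<noteq> c"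
    and "q \<in> span (m ` F)" "T q = scale c q"
  shows "q = 0"
  using assms(3-)
proof (induction F arbitrary: q rule: finite_induct)
  case empty
  then show ?case by simp
next
  case (insert i F)
  interpret T: Vector_Spaces.linear scale scale T
    by unfold_locales (simp_all add: T)
  have T_span: "T r \<in> span (m ` F)" if "r \<in> span (m ` F)" for r
    using that
  proof (induction rule: span_induct_alt)
    case base
    then show ?case by (simp add: T.zero span_zero)
  next
    case (step a x y)
    then show ?case
      using insert.prems(1) by (auto simp: T span_base intro!: span_add span_scale)
  qed
  obtain a where r: "q - scale a (m i) \<in> span (m ` F)"
    using insert.prems(3) by (auto simp: span_insert)
  define r where "r = q - scale a (m i)"
  have "T q - scale (f i) q = T r - scale (f i) r"
    using insert.prems(1)[of i] by (simp add: r_def T.diff T scale_right_diff_distrib scale_left_commute)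
  also have "\<dots> \<in> span (m ` F)"
    using r T_span by (auto simp: r_def intro!: span_diff span_scale)
  finally have "scale (c - f i) q \<in> span (m ` F)"
    by (simp add: insert.prems(4) scale_left_diff_distrib)
  then have "q \<in> span (m ` F)"
    using span_scale[of "scale (c - f i) q" "m ` F" "inverse (c - f i)"] insert.prems(2)[of i] by simp
  then show ?case
    using insert by auto
qed

text \<open>The family is indexed, rather than a set of vectors, because in the applications the \<open>m i\<close> need be
  neither distinct nor nonzero. The part of \<open>t\<close> in the other eigenspaces is itself an eigenvector for \<open>c\<close>,
  hence zero.\<close>

lemma (in vector_space) eigenvector_in_span_of_eigenvectors:
  assumes T: "\<And>x y. T (x + y) = T x + T y" "\<And>a x. T (scale a x) = scale a (T x)"
    and m: "\<And>i. i \<in> I \<Longrightarrow> T (m i) = scale (f i) (m i)"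
    and t: "t \<in> span (m ` I)" "T t = scale c t"
  shows "t \<in> span (m ` {i \<in> I. f i = c})"
proof -
  interpret T: Vector_Spaces.linear scale scale T
    by unfold_locales (simp_all add: T)
  let ?J = "{i \<in> I. f i = c}"
  have "m ` I = m ` ?J \<union> m ` (I - ?J)"
    by auto
  then obtain p q where pq: "t = p + q" "p \<in> span (m ` ?J)" "q \<in> span (m ` (I - ?J))"
    using t(1) by (auto simp: span_Un)
  have "T p = scale c p"
    using pq(2)
    by (induction rule: span_induct_alt) (auto simp: T T.zero m scale_right_distrib scale_left_commute)
  then have Tq: "T q = scale c q"
    using t(2) pq(1) by (simp add: T scale_right_distrib)
  obtain S where S: "finite S" "S \<subseteq> m ` (I - ?J)" "q \<in> span S"
    using pq(3) unfolding span_explicit by (auto intro: span_sum span_scale span_base)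
  then obtain F where F: "finite F" "F \<subseteq> I - ?J" "S = m ` F"
    by (meson finite_subset_image)
  have "q = 0"
    by (rule eigenvector_in_span_of_others[of T F m f c]) (use T F S m Tq in auto)
  with pq show ?thesis by simp
qed

text \<open>Independence of eigenvectors for distinct eigenvalues, in the form in which a decomposition is compared
  with zero.\<close>

lemma (in vector_space) eigenvectors_sum_zero:
  assumes T: "\<And>x y. T (x + y) = T x + T y" "\<And>a x. T (scale a x) = scale a (T x)"
    and C: "finite C" "\<And>c. c \<in> C \<Longrightarrow> T (u c) = scale c (u c)" "(\<Sum>c\<in>C. u c) = 0" "d \<in> C"
  shows "u d = 0"
proof (rule eigenvector_in_span_of_others[of T "C - {d}" u "\<lambda>c. c" d])
  have "u d = - (\<Sum>c\<in>C - {d}. u c)"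
    using C by (simp add: sum.remove eq_neg_iff_add_eq_0)
  also have "\<dots> \<in> span (u ` (C - {d}))"
    by (intro span_neg span_sum span_base) auto
  finally show "u d \<in> span (u ` (C - {d}))" .
qed (use assms in auto)

lemma (in vector_space) eigenvector_decomposition:
  assumes T: "\<And>x y. T (x + y) = T x + T y" "\<And>a x. T (scale a x) = scale a (T x)"
    and v: "v \<in> span {x. \<exists>c. T x = scale c x}"
  obtains C u where "finite C" "\<And>c. c \<in> C \<Longrightarrow> T (u c) = scale c (u c)" "v = (\<Sum>c\<in>C. u c)"
proof -
  interpret T: Vector_Spaces.linear scale scale T
    by unfold_locales (simp_all add: T)
  obtain S r where S: "finite S" "S \<subseteq> {x. \<exists>c. T x = scale c x}" "v = (\<Sum>x\<in>S. scale (r x) x)"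
    using v unfolding span_explicit by blast
  then obtain e where e: "\<And>x. x \<in> S \<Longrightarrow> T x = scale (e x) x"
    using bchoice[of S "\<lambda>x c. T x = scale c x"] by blast
  show thesis
  proof (rule that)
    show "finite (e ` S)" using S(1) by simp
    show "T (\<Sum>x\<in>{x \<in> S. e x = c}. scale (r x) x) = scale c (\<Sum>x\<in>{x \<in> S. e x = c}. scale (r x) x)" for c
      by (auto simp: T.sum T scale_sum_right e scale_left_commute intro!: sum.cong)
    show "v = (\<Sum>c\<in>e ` S. \<Sum>x\<in>{x \<in> S. e x = c}. scale (r x) x)"
      unfolding S(3) by (rule sum.image_gen[OF S(1)])
  qed
qed

text \<open>Simultaneous diagonalization, one operator at a time: the components of a common eigenvector of \<open>G\<close> with
  respect to a further operator \<open>T j\<close> are again eigenvectors for \<open>G\<close>, since \<open>T i - \<mu> i\<close> commutes with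
  \<open>T j\<close> and eigenvectors of \<open>T j\<close> for distinct eigenvalues are independent.\<close>

lemma (in vector_space) span_common_eigenvectors:
  fixes T :: "'i \<Rightarrow> 'b \<Rightarrow> 'b"
  assumes T: "\<And>i x y. i \<in> G \<Longrightarrow> T i (x + y) = T i x + T i y"
      "\<And>i a x. i \<in> G \<Longrightarrow> T i (scale a x) = scale a (T i x)"
    and comm: "\<And>i j x. i \<in> G \<Longrightarrow> j \<in> G \<Longrightarrow> T i (T j x) = T j (T i x)"
    and diag: "\<And>i. i \<in> G \<Longrightarrow> span {x. \<exists>c. T i x = scale c x} = UNIV"
    and "finite G"
  shows "span {x. \<forall>i\<in>G. \<exists>c. T i x = scale c x} = UNIV"
  using assms(5,1-4)
proof (induction G rule: finite_induct)
  case empty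
  then show ?case by simp
next
  case (insert j G)
  let ?E = "\<lambda>G. {x. \<forall>i\<in>G. \<exists>c. T i x = scale c x}"
  have "?E G \<subseteq> span (?E (insert j G))"
  proof
    fix v
    assume v: "v \<in> ?E G"
    then obtain \<mu> where \<mu>: "\<And>i. i \<in> G \<Longrightarrow> T i v = scale (\<mu> i) v"
      using bchoice[of G "\<lambda>i c. T i v = scale c v"] by blast
    obtain C u where C: "finite C" "\<And>c. c \<in> C \<Longrightarrow> T j (u c) = scale c (u c)" "v = (\<Sum>c\<in>C. u c)"
      by (rule eigenvector_decomposition[of "T j" v]) (use insert.prems in auto)
    have "T i (u d) = scale (\<mu> i) (u d)" if i: "i \<in> G" and d: "d \<in> C" for i d
    proof -
      interpret Ti: Vector_Spaces.linear scale scale "T i"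
        by unfold_locales (use insert.prems i in auto)
      interpret Tj: Vector_Spaces.linear scale scale "T j"
        by unfold_locales (use insert.prems in auto)
      have "T i (u d) - scale (\<mu> i) (u d) = 0"
      proof (rule eigenvectors_sum_zero[of "T j" C "\<lambda>c. T i (u c) - scale (\<mu> i) (u c)"])
        show "T j (T i (u c) - scale (\<mu> i) (u c)) = scale c (T i (u c) - scale (\<mu> i) (u c))" if "c \<in> C" for c
          using insert.prems(3)[of j i "u c"] i C(2)[OF that]
          by (simp add: Tj.diff Tj.scale Ti.scale scale_right_diff_distrib scale_left_commute)
        show "(\<Sum>c\<in>C. T i (u c) - scale (\<mu> i) (u c)) = 0"
          using \<mu>[OF i] C(3) by (simp add: sum_subtractf Ti.sum scale_sum_right)
      qed (use C d insert.prems in auto)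
      then show ?thesis by simp
    qed
    then have "u d \<in> ?E (insert j G)" if "d \<in> C" for d
      using C(2) that by auto
    then show "v \<in> span (?E (insert j G))"
      unfolding C(3) by (intro span_sum span_base)
  qed
  then have "span (?E G) \<subseteq> span (?E (insert j G))"
    by (simp add: span_minimal)
  moreover have "span (?E G) = UNIV"
    by (rule insert.IH) (use insert.prems in auto)
  ultimately show ?case by auto
qed

text \<open>The value of \<open>p(A) u\<close>, computed by Horner's scheme.\<close>

definition krylov :: "complex ^ 'm ^ 'm \<Rightarrow> complex ^ 'm \<Rightarrow> complex poly \<Rightarrow> complex ^ 'm" where
  "krylov A u p = fold_coeffs (\<lambda>a x. a *s u + A *v x) p 0"

lemma krylov_0 [simp]: "krylov A u 0 = 0"
  by (simp add: krylov_def)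

lemma krylov_pCons [simp]: "krylov A u (pCons a p) = a *s u + A *v krylov A u p"
  by (cases "p = 0 \<and> a = 0") (auto simp: krylov_def)

lemma krylov_add: "krylov A u (p + q) = krylov A u p + krylov A u q"
  by (induction p q rule: poly_induct2) (simp_all add: algebra_simps matrix_vector_right_distrib)

lemma krylov_smult: "krylov A u (smult c p) = c *s krylov A u p"
  by (induction p) (simp_all add: algebra_simps vector_add_ldistrib vec.scale)

text \<open>The vectors \<open>u, A u, A\<^sup>2 u, \<dots>\<close> are dependent, so some nonzero polynomial \<open>p\<close> has \<open>p(A) u = 0\<close>. If its
  degree is minimal and \<open>c\<close> is a root, the quotient of \<open>p\<close> by \<open>X - c\<close> yields an eigenvector.\<close>

lemma complex_matrix_eigenvector:
  fixes A :: "complex ^ 'm ^ 'm"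
  obtains u c where "u \<noteq> 0" "A *v u = c *s u"
proof -
  obtain k :: 'm where True by simp
  define u :: "complex ^ 'm" where "u = axis k 1"
  have u: "u \<noteq> 0"
    by (auto simp: u_def)
  have "\<exists>p. p \<noteq> 0 \<and> krylov A u p = 0"
  proof (rule ccontr)
    assume "\<nexists>p. p \<noteq> 0 \<and> krylov A u p = 0"
    then have nz: "krylov A u p \<noteq> 0" if "p \<noteq> 0" for p
      using that by blast
    let ?f = "\<lambda>i. krylov A u (monom 1 i)"
    have sum: "(\<Sum>i\<in>F. g i *s ?f i) = krylov A u (\<Sum>i\<in>F. monom (g i) i)" if "finite F" for F g
      using that by induction (simp_all add: krylov_add flip: krylov_smult add: smult_monom)
    have inj: "inj ?f"
    proof (rule injI)
      fix i j assume "?f i = ?f j"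
      then have "krylov A u (monom 1 i + smult (-1) (monom 1 j)) = 0"
        by (simp only: krylov_add krylov_smult) simp
      then have "monom (1::complex) i + smult (-1) (monom 1 j) = 0"
        using nz by blast
      then have "monom (1::complex) i = monom 1 j"
        by simp
      then show "i = j"
        by (metis degree_monom_eq zero_neq_one)
    qed
    have "vec.independent (?f ` {..CARD('m)})"
    proof (rule vec.independent_if_scalars_zero)
      fix g x
      assume g: "(\<Sum>x\<in>?f ` {..CARD('m)}. g x *s x) = 0" and x: "x \<in> ?f ` {..CARD('m)}"
      have "krylov A u (\<Sum>i\<le>CARD('m). monom (g (?f i)) i) = 0"
        using g by (simp add: sum.reindex inj_on_subset[OF inj] flip: sum)
      then have zero: "(\<Sum>i\<le>CARD('m). monom (g (?f i)) i) = 0"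
        using nz by blast
      have "g (?f j) = 0" if "j \<le> CARD('m)" for j
        using that arg_cong[OF zero, of "\<lambda>p. coeff p j"] by (simp add: coeff_sum)
      then show "g x = 0" using x by auto
    qed simp
    then have "card (?f ` {..CARD('m)}) \<le> CARD('m)"
      using vec.independent_card_le_dim[of "?f ` {..CARD('m)}" UNIV]
      by (simp add: vec.dimension_def card_cart_basis)
    then show False
      by (simp add: card_image inj_on_subset[OF inj])
  qed
  then obtain p where p: "p \<noteq> 0" "krylov A u p = 0" and
    min: "\<And>r. r \<noteq> 0 \<Longrightarrow> krylov A u r = 0 \<Longrightarrow> degree p \<le> degree r"
    using ex_has_least_nat[of "\<lambda>p. p \<noteq> 0 \<and> krylov A u p = 0" _ degree] by blast
  have "degree p \<noteq> 0"
  proof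
    assume "degree p = 0"
    then obtain a where "p = [:a:]"
      by (rule degree_eq_zeroE)
    with p u show False by auto
  qed
  then obtain c where "poly p c = 0"
    using fundamental_theorem_of_algebra[of p] by (auto simp: constant_degree)
  then obtain r where r: "p = [:- c, 1:] * r"
    by (auto simp: poly_eq_0_iff_dvd)
  with p have "r \<noteq> 0" by auto
  with r have "degree r < degree p"
    by (simp add: degree_mult_eq del: mult_pCons_left)
  with min \<open>r \<noteq> 0\<close> have "krylov A u r \<noteq> 0"
    by fastforce
  moreover have "p = smult (- c) r + pCons 0 r"
    using r by simp
  then have "krylov A u p = - c *s krylov A u r + A *v krylov A u r"
    by (simp only: krylov_add krylov_smult krylov_pCons) simp
  then have "A *v krylov A u r = c *s krylov A u r"
    using p(2) by (simp add: add_eq_0_iff2)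
  ultimately show thesis by (rule that)
qed


section \<open>Rank-two generators of the symplectic Lie algebra and its Killing form\<close>

definition act :: "'n::finite sp \<Rightarrow> complex ^ ('n + 'n) \<Rightarrow> complex ^ ('n + 'n)" where
  "act X v = matrix_of_sp X *v v"

lemma sp_eqI: "(\<And>v. act X v = act Y v) \<Longrightarrow> X = Y"
  by (simp add: act_def matrix_eq flip: matrix_of_sp_inject)

lemma act_linear [simp]:
  "act X (u + v) = act X u + act X v" "act X (u - v) = act X u - act X v" "act X (- v) = - act X v"
  "act X (c *s v) = c *s act X v" "act X 0 = 0" "act X (sum f A) = (\<Sum>i\<in>A. act X (f i))"
  by (simp_all add: act_def vec.add vec.diff vec.neg vec.scale vec.sum)

lemma act_sp_linear [simp]:
  "act (X + Y) v = act X v + act Y v" "act (X - Y) v = act X v - act Y v"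
  "act (c *\<^sub>C X) v = c *s act X v" "act 0 v = 0"
  by (simp_all add: act_def plus_sp.rep_eq minus_sp.rep_eq scaleC_sp.rep_eq zero_sp.rep_eq
      matrix_vector_mult_add_rdistrib matrix_vector_mult_diff_rdistrib map_matrix_mult_vec)

lemma act_sum_sp [simp]: "act (sum f A) v = (\<Sum>i\<in>A. act (f i) v)"
  by (induction A rule: infinite_finite_induct) simp_all

lemma act_bracket: "act (bracket X Y) v = act X (act Y v) - act Y (act X v)"
  by (simp add: act_def bracket_sp.rep_eq matrix_vector_mult_diff_rdistrib matrix_vector_mul_assoc)

lemma symp_form_act: "symp_form (act X u) v = - symp_form u (act X v)"
  using matrix_of_sp[of X] by (simp add: act_def symplectic_iff)

lemma symp_form_self [simp]: "symp_form a a = 0"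
  by (simp add: symp_form_def mult.commute)

lemma symp_form_sum:
  "symp_form (sum f A) y = (\<Sum>i\<in>A. symp_form (f i) y)"
  "symp_form x (sum g A) = (\<Sum>i\<in>A. symp_form x (g i))"
  by (induction A rule: infinite_finite_induct) (simp_all add: symp_form_add_left symp_form_add_right)

lemmas symp_form_linear =
  symp_form_add_left symp_form_add_right symp_form_diff_left symp_form_diff_right
  symp_form_scale_left symp_form_scale_right symp_form_sum

text \<open>The product \<open>ab\<close> under the isomorphism of the symmetric square of \<open>V\<close> with \<open>\<gg>\<close>.\<close>

lift_definition sp_prod :: "complex ^ ('n::finite + 'n) \<Rightarrow> complex ^ ('n + 'n) \<Rightarrow> 'n sp"
  is "\<lambda>a b. matrix (\<lambda>v. symp_form a v *s b + symp_form b v *s a)"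
proof -
  fix a b :: "complex ^ ('n + 'n)"
  have "Vector_Spaces.linear (*s) (*s) (\<lambda>v. symp_form a v *s b + symp_form b v *s a)"
    by unfold_locales (simp_all add: symp_form_linear algebra_simps vector_add_ldistrib)
  then show "symplectic (matrix (\<lambda>v. symp_form a v *s b + symp_form b v *s a))"
    by (simp add: symplectic_iff matrix_works symp_form_linear symp_form_skew[of _ a] symp_form_skew[of _ b])
qed

lemma act_sp_prod: "act (sp_prod a b) v = symp_form a v *s b + symp_form b v *s a"
proof -
  have "Vector_Spaces.linear (*s) (*s) (\<lambda>v. symp_form a v *s b + symp_form b v *s a)"
    by unfold_locales (simp_all add: symp_form_linear algebra_simps vector_add_ldistrib)
  then show ?thesis
    by (simp add: act_def sp_prod.rep_eq matrix_works)
qed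

lemma sp_prod_commute: "sp_prod a b = sp_prod b a"
  by (rule sp_eqI) (simp add: act_sp_prod add.commute)

lemma sp_prod_linear [simp]:
  "sp_prod (a + a') b = sp_prod a b + sp_prod a' b" "sp_prod a (b + b') = sp_prod a b + sp_prod a b'"
  "sp_prod (a - a') b = sp_prod a b - sp_prod a' b" "sp_prod a (b - b') = sp_prod a b - sp_prod a b'"
  "sp_prod (c *s a) b = c *\<^sub>C sp_prod a b" "sp_prod a (c *s b) = c *\<^sub>C sp_prod a b"
  "sp_prod 0 b = 0" "sp_prod a 0 = 0"
  by (rule sp_eqI, simp add: act_sp_prod symp_form_linear algebra_simps vector_add_ldistrib)+

lemma sp_prod_sum:
  "sp_prod (sum f A) b = (\<Sum>i\<in>A. sp_prod (f i) b)" "sp_prod a (sum g A) = (\<Sum>i\<in>A. sp_prod a (g i))"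
  by (induction A rule: infinite_finite_induct) simp_all

lemma bracket_sp_prod: "bracket Z (sp_prod a b) = sp_prod (act Z a) b + sp_prod a (act Z b)"
proof (rule sp_eqI)
  fix v
  have "symp_form a (act Z v) = - symp_form (act Z a) v" "symp_form b (act Z v) = - symp_form (act Z b) v"
    by (simp_all add: symp_form_act)
  then show "act (bracket Z (sp_prod a b)) v = act (sp_prod (act Z a) b + sp_prod a (act Z b)) v"
    by (simp add: act_bracket act_sp_prod)
qed

text \<open>The basis of \<open>V\<close> that is dual to the standard one under the symplectic form.\<close>

definition dual_axis :: "'n::finite + 'n \<Rightarrow> complex ^ ('n + 'n)" where
  "dual_axis i = (case i of Inl k \<Rightarrow> - axis (Inr k) 1 | Inr k \<Rightarrow> axis (Inl k) 1)"

lemma symp_form_axis: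
  "symp_form (axis (Inl k) 1) v = v $ Inr k" "symp_form (axis (Inr k) 1) v = - (v $ Inl k)"
  "symp_form v (axis (Inl k) 1) = - (v $ Inr k)" "symp_form v (axis (Inr k) 1) = v $ Inl k"
  by (simp_all add: symp_form_def axis_def if_distrib[of "(*) _"] if_distrib[of "\<lambda>x. x * _"] sum_negf
      cong: if_cong)

lemma symp_form_dual_axis: "symp_form (dual_axis i) v = v $ i"
  by (simp add: dual_axis_def symp_form_axis split: sum.split)

lemma sum_UNIV_Plus:
  fixes f :: "'a::finite + 'b::finite \<Rightarrow> 'c::comm_monoid_add"
  shows "(\<Sum>i\<in>UNIV. f i) = (\<Sum>k\<in>UNIV. f (Inl k)) + (\<Sum>k\<in>UNIV. f (Inr k))"
  by (subst UNIV_Plus_UNIV[symmetric], subst sum.Plus) simp_all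

lemma dual_axis_expansion:
  "(\<Sum>j\<in>UNIV. symp_form v (axis j 1) *s dual_axis j) = (v :: complex ^ ('n::finite + 'n))"
proof -
  have "(\<Sum>j\<in>UNIV. symp_form v (axis j 1) *s dual_axis j) = (\<Sum>j\<in>UNIV. v $ j *s axis j 1)"
    by (simp add: sum_UNIV_Plus symp_form_axis dual_axis_def add.commute)
  then show ?thesis
    by (simp add: basis_expansion)
qed

text \<open>A symplectic \<open>X\<close> is \<open>\<Sum>\<^sub>j \<omega>(e\<^sub>j\<^sup>*, \<cdot>) X e\<^sub>j\<close>; moving \<open>X\<close> across the form shows that it is also
  \<open>\<Sum>\<^sub>j \<omega>(X e\<^sub>j, \<cdot>) e\<^sub>j\<^sup>*\<close>. The formula is the mean of the two.\<close>

lemma sp_expansion: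
  "X = (1/2) *\<^sub>C (\<Sum>j\<in>UNIV. sp_prod (dual_axis j) (act X (axis j 1)))"
proof (rule sp_eqI)
  fix v
  have "symp_form (act X (axis j 1)) v = symp_form (act X v) (axis j 1)" for j
    by (subst symp_form_skew) (simp add: symp_form_act)
  then have "(\<Sum>j\<in>UNIV. symp_form (act X (axis j 1)) v *s dual_axis j) = act X v"
    by (simp only: dual_axis_expansion)
  moreover have "(\<Sum>j\<in>UNIV. v $ j *s act X (axis j 1)) = act X v"
    using basis_expansion[of v] by (metis (no_types, lifting) act_linear(4,6) sum.cong)
  ultimately show "act X v = act ((1/2) *\<^sub>C (\<Sum>j\<in>UNIV. sp_prod (dual_axis j) (act X (axis j 1)))) v"
    by (simp add: act_sp_prod symp_form_dual_axis sum.distrib vector_add_ldistrib)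
      (simp add: vec_eq_iff)
qed

lemma sp_frame_expansion:
  "X = (\<Sum>(i, j)\<in>UNIV. (act X (axis j 1) $ i / 2) *\<^sub>C sp_prod (dual_axis j) (axis i 1))"
proof -
  have "sp_prod (dual_axis j) (act X (axis j 1)) =
      (\<Sum>i\<in>UNIV. (act X (axis j 1) $ i) *\<^sub>C sp_prod (dual_axis j) (axis i 1))" for j
    by (subst basis_expansion[of "act X (axis j 1)", symmetric]) (simp only: sp_prod_sum sp_prod_linear)
  then have "X = (1/2) *\<^sub>C (\<Sum>j\<in>UNIV. \<Sum>i\<in>UNIV. (act X (axis j 1) $ i) *\<^sub>C sp_prod (dual_axis j) (axis i 1))"
    using sp_expansion[of X] by simp
  also have "\<dots> = (\<Sum>j\<in>UNIV. \<Sum>i\<in>UNIV. (act X (axis j 1) $ i / 2) *\<^sub>C sp_prod (dual_axis j) (axis i 1))"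
    by (simp add: cvec.scale_sum_right)
  also have "\<dots> = (\<Sum>(i, j)\<in>UNIV. (act X (axis j 1) $ i / 2) *\<^sub>C sp_prod (dual_axis j) (axis i 1))"
    by (subst sum.swap) (simp add: sum.cartesian_product)
  finally show ?thesis .
qed

lemma span_sp_prod: "cvec.span {sp_prod a b | a b. True} = UNIV"
proof -
  have "X \<in> cvec.span {sp_prod a b | a b. True}" for X :: "'a sp"
    by (subst sp_expansion) (intro cvec.span_scale cvec.span_sum cvec.span_base, auto)
  then show ?thesis by auto
qed

lemma finite_span_sp:
  obtains S :: "'n::finite sp set" where "finite S" "cvec.span S = UNIV"
proof
  let ?S = "range (\<lambda>p. sp_prod (dual_axis (snd p)) (axis (fst p) 1) :: 'n sp)"
  show "finite ?S" by simp
  have "X \<in> cvec.span ?S" for X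
    by (subst sp_frame_expansion)
      (unfold case_prod_beta, intro cvec.span_sum cvec.span_scale cvec.span_base rangeI)
  then show "cvec.span ?S = UNIV" by auto
qed

text \<open>The trace can be computed from any resolution of the identity \<open>x = \<Sum>\<^sub>i \<phi>\<^sub>i(x) e\<^sub>i\<close>, by expanding the
  basis vectors in it and exchanging the sums. The \<open>e\<^sub>i\<close> may be dependent, which allows the family
  of all products of basis vectors for \<open>\<gg>\<close>, without choosing half of them.\<close>

lemma endo_trace_frame:
  fixes f :: "'a::complex_vector_space \<Rightarrow> 'a"
  assumes lin: "Vector_Spaces.linear (*\<^sub>C) (*\<^sub>C) f"
    and "finite I"
    and frame: "\<And>x. x = (\<Sum>i\<in>I. \<phi> i x *\<^sub>C e i)"
    and \<phi>: "\<And>i. i \<in> I \<Longrightarrow> Vector_Spaces.linear (*\<^sub>C) (*) (\<phi> i)"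
  shows "endo_trace f = (\<Sum>i\<in>I. \<phi> i (f (e i)))"
proof -
  interpret f: Vector_Spaces.linear "(*\<^sub>C)" "(*\<^sub>C)" f by (rule lin)
  define B :: "'a set" where "B = (SOME B. cvec.independent B \<and> cvec.span B = UNIV)"
  have "\<exists>B :: 'a set. cvec.independent B \<and> cvec.span B = UNIV"
    using cvec.maximal_independent_subset[of UNIV] by (metis top.extremum_unique)
  then have B: "cvec.independent B" "cvec.span B = UNIV"
    unfolding B_def by (rule someI2_ex, simp)+
  have "x \<in> cvec.span (e ` I)" for x
    by (subst frame) (intro cvec.span_sum cvec.span_scale cvec.span_base, auto)
  then have finB: "finite B"
    using cvec.independent_span_bound[of "e ` I" B] B(1) \<open>finite I\<close> by auto
  let ?r = "cvec.representation B"
  have r_sum: "?r (\<Sum>i\<in>I. c i *\<^sub>C x i) b = (\<Sum>i\<in>I. c i * ?r (x i) b)" for c x b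
    using B \<open>finite I\<close> by (simp add: cvec.representation_sum cvec.representation_scale)
  have "endo_trace f = (\<Sum>b\<in>B. ?r (f b) b)"
    by (simp add: endo_trace_def B_def Let_def)
  also have "\<dots> = (\<Sum>b\<in>B. \<Sum>i\<in>I. \<phi> i b * ?r (f (e i)) b)"
  proof (rule sum.cong)
    fix b
    have "f b = (\<Sum>i\<in>I. \<phi> i b *\<^sub>C f (e i))"
      using arg_cong[OF frame[of b], of f] by (simp only: f.sum f.scale)
    then show "?r (f b) b = (\<Sum>i\<in>I. \<phi> i b * ?r (f (e i)) b)"
      by (simp add: r_sum)
  qed simp
  also have "\<dots> = (\<Sum>i\<in>I. \<Sum>b\<in>B. \<phi> i b * ?r (f (e i)) b)"
    by (rule sum.swap)
  also have "\<dots> = (\<Sum>i\<in>I. \<phi> i (f (e i)))"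
  proof (rule sum.cong)
    fix i assume "i \<in> I"
    then interpret \<phi>: Vector_Spaces.linear "(*\<^sub>C)" "(*)" "\<phi> i" by (rule \<phi>)
    have "(\<Sum>b\<in>B. ?r (f (e i)) b *\<^sub>C b) = f (e i)"
      using B finB by (simp add: cvec.sum_representation_eq)
    then have "\<phi> i (f (e i)) = (\<Sum>b\<in>B. ?r (f (e i)) b * \<phi> i b)"
      by (metis (no_types, lifting) \<phi>.scale \<phi>.sum sum.cong)
    then show "(\<Sum>b\<in>B. \<phi> i b * ?r (f (e i)) b) = \<phi> i (f (e i))"
      by (simp add: mult.commute)
  qed simp
  finally show ?thesis .
qed


text \<open>Up to contractions of the frame, this is the classical computation giving the Killing form as \<open>2n + 2\<close>
  times the trace form of the defining representation.\<close>

lemma killing_sp_prod_right: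
  fixes X :: "'n::finite sp"
  shows "killing X (sp_prod c d) =
    (2 * of_nat CARD('n) + 2) * (symp_form c (act X d) + symp_form d (act X c))"
proof -
  let ?Y = "sp_prod c d"
  let ?e = "\<lambda>i. axis i 1 :: complex ^ ('n + 'n)"
  let ?d = "dual_axis :: 'n + 'n \<Rightarrow> complex ^ ('n + 'n)"
  let ?T = "symp_form c (act X d) + symp_form d (act X c)"
  define \<phi> where "\<phi> = (\<lambda>(i, j) (Z :: 'n sp). act Z (?e j) $ i / 2)"
  define e where "e = (\<lambda>(i, j). sp_prod (?d j) (?e i))"
  have contract: "(\<Sum>j\<in>UNIV. symp_form a (?d j) * symp_form b (?e j)) = symp_form a b" for a b
    using arg_cong[OF dual_axis_expansion[of b], of "symp_form a"] by (simp add: symp_form_linear mult.commute)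
  have contract': "(\<Sum>j\<in>UNIV. symp_form a (?e j) * symp_form (?d j) b) = symp_form a b" for a b
    using arg_cong[OF dual_axis_expansion[of a], of "\<lambda>a. symp_form a b"] by (simp add: symp_form_linear)
  have comp: "(\<Sum>i\<in>UNIV. symp_form (act Z (?e i)) b * v $ i) = symp_form (act Z v) b" for Z :: "'n sp" and v b
  proof -
    have "act Z v = (\<Sum>i\<in>UNIV. v $ i *s act Z (?e i))"
      by (subst basis_expansion[of v, symmetric]) simp
    then show ?thesis
      by (simp add: symp_form_linear mult.commute)
  qed
  have comp1: "(\<Sum>i\<in>UNIV. symp_form (?e i) b * v $ i) = symp_form v b" for v b
    by (subst (2) basis_expansion[of v, symmetric]) (simp add: symp_form_linear mult.commute)
  have comp2: "(\<Sum>i\<in>UNIV. symp_form (act Z (act Z' (?e i))) b * v $ i) = symp_form (act Z (act Z' v)) b"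
    for Z Z' :: "'n sp" and v b
  proof -
    have "act Z (act Z' v) = (\<Sum>i\<in>UNIV. v $ i *s act Z (act Z' (?e i)))"
      by (subst basis_expansion[of v, symmetric]) simp
    then show ?thesis
      by (simp add: symp_form_linear mult.commute)
  qed
  \<comment> \<open>\<open>?Y\<close> is traceless, which kills the products of two traces; all other terms are traces of \<open>X Y\<close>.\<close>
  have trY: "(\<Sum>j\<in>UNIV. symp_form (act ?Y (?d j)) (?e j)) = 0"
    using symp_form_skew[of c d]
    by (simp add: act_sp_prod symp_form_linear sum.distrib contract)
  have trY': "(\<Sum>i\<in>UNIV. act ?Y (?e i) $ i) = 0"
    using trY by (simp add: symp_form_act symp_form_dual_axis sum_negf)
  have trYX: "(\<Sum>j\<in>UNIV. symp_form (act X (act ?Y (?d j))) (?e j)) = ?T"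
    by (simp add: act_sp_prod symp_form_linear sum.distrib contract)
  have "(\<Sum>j\<in>UNIV. symp_form (?d j) (act X (act ?Y (?e j)))) = ?T"
    by (simp add: act_sp_prod symp_form_linear sum.distrib contract')
  then have trXY: "(\<Sum>j\<in>UNIV. symp_form (act ?Y (act X (?d j))) (?e j)) = ?T"
    and trXY': "(\<Sum>i\<in>UNIV. act X (act ?Y (?e i)) $ i) = ?T"
    by (simp_all add: symp_form_act flip: symp_form_dual_axis)
  have "killing X ?Y = (\<Sum>i\<in>UNIV. \<phi> i (bracket X (bracket ?Y (e i))))"
    unfolding killing_def
  proof (rule endo_trace_frame)
    show "Vector_Spaces.linear (*\<^sub>C) (*\<^sub>C) (\<lambda>Z. bracket X (bracket ?Y Z))"
      by unfold_locales (simp_all add: bracket_add_right bracket_scale_right)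
    show "Z = (\<Sum>i\<in>UNIV. \<phi> i Z *\<^sub>C e i)" for Z
      using sp_frame_expansion[of Z] by (simp add: \<phi>_def e_def case_prod_beta)
    show "Vector_Spaces.linear (*\<^sub>C) (*) (\<phi> i)" for i
      by unfold_locales (simp_all add: \<phi>_def case_prod_beta add_divide_distrib algebra_simps)
  qed simp
  also have "\<dots> = (\<Sum>j\<in>UNIV. \<Sum>i\<in>UNIV. \<phi> (i, j) (bracket X (bracket ?Y (e (i, j)))))"
    by (subst sum.swap) (simp add: sum.cartesian_product)
  also have "\<dots> = (\<Sum>j\<in>UNIV. \<Sum>i\<in>UNIV.
      (symp_form (act X (act ?Y (?d j))) (?e j) + symp_form (?e i) (?e j) * act X (act ?Y (?d j)) $ i
      + symp_form (act ?Y (?d j)) (?e j) * act X (?e i) $ i + symp_form (act X (?e i)) (?e j) * act ?Y (?d j) $ i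
      + symp_form (act X (?d j)) (?e j) * act ?Y (?e i) $ i + symp_form (act ?Y (?e i)) (?e j) * act X (?d j) $ i
      + act X (act ?Y (?e i)) $ i + symp_form (act X (act ?Y (?e i))) (?e j) * ?d j $ i) / 2)"
    by (intro sum.cong refl)
      (simp add: \<phi>_def e_def bracket_sp_prod bracket_add_right act_sp_prod[of "act _ _"] act_sp_prod[of "dual_axis _"]
        act_sp_prod[of "act _ _" "act _ _"] symp_form_dual_axis algebra_simps)
  also have "\<dots> = (2 * of_nat CARD('n) + 2) * ?T"
    by (simp add: sum.distrib comp comp1 comp2 trYX trXY trXY' trY trY' flip: sum_divide_distrib sum_distrib_left sum_distrib_right)
      (simp add: field_simps)
  finally show ?thesis .
qed

lemma killing_sp_prod:
  fixes a b c d :: "complex ^ ('n::finite + 'n)"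
  shows "killing (sp_prod a b) (sp_prod c d) =
    - 4 * (of_nat CARD('n) + 1) * (symp_form a c * symp_form b d + symp_form a d * symp_form b c)"
  by (simp add: killing_sp_prod_right act_sp_prod symp_form_linear symp_form_skew[of c] symp_form_skew[of d] algebra_simps)


section \<open>The highest root, for any Cartan subalgebra and any positive system\<close>

lemma symp_form_nonzero_witness:
  assumes "a \<noteq> 0"
  obtains p where "symp_form p a = 1"
proof -
  obtain y where "symp_form a y \<noteq> 0"
    using symp_form_nondegenerate[of a] assms by blast
  then have "symp_form ((- inverse (symp_form a y)) *s y) a = 1"
    using symp_form_skew[of y a] by (simp add: symp_form_scale_left)
  then show thesis by (rule that)
qed

text \<open>The Lie algebra acts on \<open>V\<close> so richly that every invariance argument below may move a nonzero vector
  to an arbitrary one.\<close>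

lemma act_transitive:
  assumes "a \<noteq> 0"
  obtains Z where "act Z a = b"
proof -
  obtain p where "symp_form p a = 1"
    using assms by (rule symp_form_nonzero_witness)
  then have "act (sp_prod p b - (symp_form b a / 2) *\<^sub>C sp_prod p p) a = b"
    by (simp add: act_sp_prod) (simp add: vec_eq_iff)
  then show thesis by (rule that)
qed

lemma act_sp_prod_self: "act (sp_prod a a) v = (2 * symp_form a v) *s a"
  by (simp add: act_sp_prod vec_eq_iff)

lemma sp_prod_self_nonzero:
  assumes "a \<noteq> 0"
  shows "sp_prod a a \<noteq> 0"
proof
  assume zero: "sp_prod a a = 0"
  obtain p where p: "symp_form p a = 1"
    using assms by (rule symp_form_nonzero_witness)
  then have "symp_form p (act (sp_prod a a) p) = -2"
    using symp_form_skew[of a p] by (simp add: act_sp_prod_self symp_form_linear)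
  with zero show False by simp
qed

lemma bracket_skew: "bracket x y = - bracket y (x :: 'g::complex_lie_algebra)"
  using bracket_self[of "x + y"] unfolding bracket_add_left bracket_add_right
  by (simp add: bracket_self eq_neg_iff_add_eq_0 add.commute)

text \<open>If \<open>u\<close> is an eigenvector of \<open>H\<close> on \<open>V\<close> and \<open>X\<close> one of \<open>ad H\<close>, then \<open>X u\<close> is again an eigenvector of
  \<open>H\<close>. Such \<open>X\<close> span \<open>\<gg>\<close>, and \<open>\<gg> u\<close> is all of \<open>V\<close>. This replaces the Jordan decomposition.\<close>

lemma span_eigenvectors_of_ad_diagonalizable:
  fixes H :: "'n::finite sp"
  assumes "cvec.span {X. \<exists>c. bracket H X = c *\<^sub>C X} = UNIV"
  shows "vec.span {v. \<exists>c. act H v = c *s v} = UNIV"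
proof -
  obtain u e where u: "u \<noteq> 0" "act H u = e *s u"
    using complex_matrix_eigenvector[of "matrix_of_sp H"] unfolding act_def by metis
  let ?S = "vec.span {v. \<exists>c. act H v = c *s v}"
  have act: "act X u \<in> ?S" for X
  proof -
    have "X \<in> cvec.span {X. \<exists>c. bracket H X = c *\<^sub>C X}"
      using assms by simp
    then show ?thesis
    proof (induction rule: cvec.span_induct_alt)
      case base
      then show ?case by (simp add: vec.span_zero)
    next
      case (step a X Y)
      then obtain c where "bracket H X = c *\<^sub>C X" by auto
      then have "act H (act X u) = (c + e) *s act X u"
        using act_bracket[of H X u] u(2) by (simp add: vector_sadd_rdistrib algebra_simps)
      then have "act X u \<in> ?S"
        by (intro vec.span_base) blast
      then show ?case
        using step by (simp add: vec.span_add vec.span_scale)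
    qed
  qed
  have "v \<in> ?S" for v
  proof -
    obtain Z where "act Z u = v"
      using act_transitive[OF u(1)] .
    with act[of Z] show ?thesis by simp
  qed
  then show ?thesis by auto
qed

text \<open>The general notion of a weight space is for modules over the complex vector space class, to which the
  standard type of coordinate vectors does not belong.\<close>

definition weight_vector :: "'n::finite sp set \<Rightarrow> ('n sp \<Rightarrow> complex) \<Rightarrow> complex ^ ('n + 'n) \<Rightarrow> bool" where
  "weight_vector h \<mu> a \<longleftrightarrow> a \<noteq> 0 \<and> (\<forall>H\<in>h. act H a = \<mu> H *s a)"

context
  fixes h :: "'n::finite sp set"
  assumes h: "cartan_subalgebra h"
begin

text \<open>Each element of \<open>h\<close> is diagonalizable on \<open>V\<close>, and a finite spanning set of \<open>h\<close> is simultaneously so.\<close>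

lemma span_weight_vectors: "vec.span {a. \<exists>\<mu>. weight_vector h \<mu> a} = UNIV"
proof -
  obtain B where B: "B \<subseteq> h" "cvec.independent B" "h \<subseteq> cvec.span B"
    using cvec.maximal_independent_subset[of h] by blast
  obtain S :: "'n sp set" where "finite S" "cvec.span S = UNIV"
    by (rule finite_span_sp)
  then have "finite B"
    using cvec.independent_span_bound[of S B] B(2) by auto
  have comm: "act H (act K v) = act K (act H v)" if "H \<in> B" "K \<in> B" for H K v
  proof -
    have "bracket H K = 0"
      using h that B(1) unfolding cartan_subalgebra_def by blast
    then show ?thesis
      using act_bracket[of H K v] by simp
  qed
  \<comment> \<open>A finite \<open>B\<close> spanning \<open>h\<close> is needed because the induction runs over finitely many operators.\<close>
  have span: "vec.span {v. \<forall>H\<in>B. \<exists>c. act H v = c *s v} = UNIV"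
  proof (rule vec.span_common_eigenvectors[of B act])
    show "vec.span {v. \<exists>c. act H v = c *s v} = UNIV" if "H \<in> B" for H
    proof (rule span_eigenvectors_of_ad_diagonalizable)
      show "cvec.span {X. \<exists>c. bracket H X = c *\<^sub>C X} = UNIV"
        using h B(1) that unfolding cartan_subalgebra_def by blast
    qed
    show "act H (act K v) = act K (act H v)" if "H \<in> B" "K \<in> B" for H K v
      using that by (rule comm)
  qed (simp_all add: \<open>finite B\<close>)
  have "v \<in> vec.span {a. \<exists>\<mu>. weight_vector h \<mu> a}" if v: "\<forall>H\<in>B. \<exists>c. act H v = c *s v" for v
  proof (cases "v = 0")
    case True
    then show ?thesis by (simp add: vec.span_zero)
  next
    case False
    have "\<exists>c. act H v = c *s v" if "H \<in> cvec.span B" for H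
      using that
    proof (induction rule: cvec.span_induct_alt)
      case base
      then show ?case by (auto intro: exI[of _ 0])
    next
      case (step a X Y)
      with v obtain c d where "act X v = c *s v" "act Y v = d *s v" by blast
      then have "act (a *\<^sub>C X + Y) v = (a * c + d) *s v"
        by (simp add: vector_sadd_rdistrib)
      then show ?case by blast
    qed
    then have "\<forall>H\<in>h. \<exists>c. act H v = c *s v"
      using B(3) by blast
    then have "\<exists>\<mu>. weight_vector h \<mu> v"
      using bchoice[of h "\<lambda>H c. act H v = c *s v"] False by (simp add: weight_vector_def)
    then show ?thesis
      by (intro vec.span_base) simp
  qed
  then have "vec.span {v. \<forall>H\<in>B. \<exists>c. act H v = c *s v} \<subseteq> vec.span {a. \<exists>\<mu>. weight_vector h \<mu> a}"
    by (intro vec.span_minimal) auto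
  with span show ?thesis by auto
qed

lemma weights_of_paired_vectors:
  assumes "weight_vector h \<mu> a" "weight_vector h \<nu> b" "symp_form a b \<noteq> 0" "H \<in> h"
  shows "\<nu> H = - \<mu> H"
proof -
  have "act H a = \<mu> H *s a" "act H b = \<nu> H *s b"
    using assms unfolding weight_vector_def by blast+
  then have "(\<mu> H + \<nu> H) * symp_form a b = 0"
    using symp_form_act[of H a b] by (simp add: symp_form_linear algebra_simps)
  then show ?thesis
    using assms(3) by (simp add: eq_neg_iff_add_eq_0 add.commute)
qed

text \<open>A vector orthogonal to all weight vectors would be orthogonal to \<open>V\<close>; and paired weights are opposite.\<close>

lemma dual_weight_vector:
  assumes "weight_vector h \<mu> a"
  obtains a' where "weight_vector h (\<lambda>H. - \<mu> H) a'" "symp_form a a' \<noteq> 0"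
proof -
  have "\<exists>\<nu> a'. weight_vector h \<nu> a' \<and> symp_form a a' \<noteq> 0"
  proof (rule ccontr)
    assume *: "\<not> ?thesis"
    have "symp_form a y = 0" if "y \<in> vec.span {a. \<exists>\<mu>. weight_vector h \<mu> a}" for y
      using that
    proof (induction rule: vec.span_induct_alt)
      case (step c x y)
      with * have "symp_form a x = 0" by blast
      with step.IH show ?case by (simp add: symp_form_linear)
    qed simp
    then have "symp_form a y = 0" for y
      using span_weight_vectors by simp
    then have "a = 0"
      by (rule symp_form_nondegenerate)
    with assms show False by (simp add: weight_vector_def)
  qed
  then obtain a' \<nu> where a': "weight_vector h \<nu> a'" "symp_form a a' \<noteq> 0"
    by blast
  then have "weight_vector h (\<lambda>H. - \<mu> H) a'"
    using weights_of_paired_vectors[OF assms a'] by (simp add: weight_vector_def)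
  then show thesis by (rule that[OF _ a'(2)])
qed

lemma bracket_weight_vectors:
  assumes "weight_vector h \<mu> a" "weight_vector h \<nu> b" "H \<in> h"
  shows "bracket H (sp_prod a b) = (\<mu> H + \<nu> H) *\<^sub>C sp_prod a b"
  using assms by (simp add: weight_vector_def bracket_sp_prod cvec.scale_left_distrib)

text \<open>This is where maximality of \<open>h\<close> enters: \<open>a a'\<close> has weight zero, so it centralizes \<open>h\<close>. In particular
  \<open>h\<close> contains an element on which the weight of \<open>a\<close> is nonzero.\<close>

lemma sp_prod_dual_in_cartan:
  assumes "weight_vector h \<mu> a" "weight_vector h (\<lambda>H. - \<mu> H) a'"
  shows "sp_prod a a' \<in> h"
  using h bracket_weight_vectors[OF assms] by (auto simp: cartan_subalgebra_def)

lemma weight_of_sp_prod_dual: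
  assumes "weight_vector h \<mu> a" "weight_vector h (\<lambda>H. - \<mu> H) a'"
  shows "\<mu> (sp_prod a a') = symp_form a' a"
proof -
  have "\<mu> (sp_prod a a') *s a = symp_form a' a *s a"
    using assms(1) sp_prod_dual_in_cartan[OF assms] act_sp_prod[of a a' a] by (simp add: weight_vector_def)
  then show ?thesis
    using assms(1) by (simp add: weight_vector_def)
qed

text \<open>One of the two opposite roots \<open>\<mu> + \<nu>\<close> and \<open>- \<mu> - \<nu>\<close> is positive, and the highest weight vector \<open>v\<close>
  is killed by its root vector.\<close>

lemma positive_system_cases:
  assumes \<Phi>: "positive_system h \<Phi>"
    and v: "\<forall>\<alpha>\<in>\<Phi>. \<forall>E\<in>weight_space h bracket \<alpha>. bracket E v = 0"
    and ab: "weight_vector h \<mu> a" "weight_vector h \<nu> b" "sp_prod a b \<noteq> 0"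
    and ab': "weight_vector h (\<lambda>H. - \<mu> H) a'" "weight_vector h (\<lambda>H. - \<nu> H) b'"
    and nz: "H \<in> h" "\<mu> H + \<nu> H \<noteq> 0"
  shows "bracket v (sp_prod a b) = 0 \<or> bracket v (sp_prod a' b') = 0"
proof -
  define \<alpha> where "\<alpha> = (\<lambda>H. if H \<in> h then \<mu> H + \<nu> H else 0)"
  have ws: "sp_prod a b \<in> weight_space h bracket \<alpha>" "sp_prod a' b' \<in> weight_space h bracket (\<lambda>H. - \<alpha> H)"
    using bracket_weight_vectors[OF ab(1,2)] bracket_weight_vectors[OF ab'(1,2)]
    by (simp_all add: weight_space_def \<alpha>_def)
  have "\<alpha> \<in> roots h"
    using ws(1) ab(3) nz by (auto simp: roots_def \<alpha>_def)
  then have "\<alpha> \<in> \<Phi> \<or> (\<lambda>H. - \<alpha> H) \<in> \<Phi>"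
    using \<Phi> by (auto simp: positive_system_def)
  then have "bracket (sp_prod a b) v = 0 \<or> bracket (sp_prod a' b') v = 0"
    using v ws by blast
  then show ?thesis
    using bracket_skew[of v "sp_prod a b"]
      bracket_skew[of v "sp_prod a' b'"] by auto
qed

text \<open>The highest root is \<open>2 \<nu>\<close> for the weight \<open>\<nu>\<close> of some vector \<open>b\<close> of \<open>V\<close>. To find \<open>b\<close>, take a
  weight vector \<open>a\<close> that the highest weight vector \<open>v\<close> does not kill and put \<open>b = v a\<close>, of weight
  \<open>\<nu> = \<mu> + \<theta>\<close>. Let \<open>a'\<close> and \<open>b'\<close> be dual weight vectors. If \<open>\<nu> \<noteq> - \<mu>\<close>, then \<open>v\<close> commutes neither with
  \<open>ab\<close> nor with \<open>a'b'\<close> (with \<open>aa\<close> and \<open>a'a'\<close> instead if \<open>\<nu> = \<mu>\<close>), although one of the two belongs to a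
  positive root. The conclusion evaluates \<open>\<theta>\<close> only at \<open>bb'\<close>, which suffices to recognise vectors of weight
  \<open>2 \<theta>\<close>.\<close>

lemma highest_root_is_long:
  assumes \<Phi>: "positive_system h \<Phi>" and \<theta>: "has_highest_weight h \<Phi> bracket UNIV \<theta>"
  obtains b b' where "sp_prod b b' \<in> h" "symp_form b' b \<noteq> 0" "\<theta> (sp_prod b b') = 2 * symp_form b' b"
proof -
  obtain v where v: "v \<noteq> 0" "v \<in> weight_space h bracket \<theta>"
    and kill: "\<forall>\<alpha>\<in>\<Phi>. \<forall>E\<in>weight_space h bracket \<alpha>. bracket E v = 0"
    using \<theta> unfolding has_highest_weight_def by (elim bexE conjE)
  have "\<exists>a \<mu>. weight_vector h \<mu> a \<and> act v a \<noteq> 0"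
  proof (rule ccontr)
    assume *: "\<not> ?thesis"
    have "act v y = 0" if "y \<in> vec.span {a. \<exists>\<mu>. weight_vector h \<mu> a}" for y
      using that
    proof (induction rule: vec.span_induct_alt)
      case (step c x y)
      with * have "act v x = 0" by blast
      with step.IH show ?case by simp
    qed simp
    then have "v = 0"
      using span_weight_vectors by (intro sp_eqI) simp
    with v(1) show False by simp
  qed
  then obtain a \<mu> where a: "weight_vector h \<mu> a" "act v a \<noteq> 0" by blast
  define b where "b = act v a"
  define \<nu> where "\<nu> = (\<lambda>H. \<mu> H + \<theta> H)"
  have b: "weight_vector h \<nu> b"
  proof -
    have "act H b = \<nu> H *s b" if "H \<in> h" for H
    proof -
      have "act (bracket H v) a = \<theta> H *s b"
        using v(2) that by (simp add: weight_space_def b_def)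
      then show ?thesis
        using a(1) that by (simp add: act_bracket weight_vector_def b_def \<nu>_def vector_sadd_rdistrib algebra_simps)
    qed
    then show ?thesis
      using a(2) by (simp add: weight_vector_def b_def)
  qed
  obtain a' where a': "weight_vector h (\<lambda>H. - \<mu> H) a'" "symp_form a a' \<noteq> 0"
    using dual_weight_vector[OF a(1)] .
  obtain b' where b': "weight_vector h (\<lambda>H. - \<nu> H) b'" "symp_form b b' \<noteq> 0"
    using dual_weight_vector[OF b] .
  have "\<nu> H = - \<mu> H" if "H \<in> h" for H
  proof (rule ccontr)
    assume H: "\<nu> H \<noteq> - \<mu> H"
    show False
    proof (cases "\<forall>K\<in>h. \<nu> K = \<mu> K")
      case True
      \<comment> \<open>Here \<open>\<theta> = 0\<close>, so \<open>v\<close> lies in \<open>h\<close> and would act on \<open>aa\<close> by the nonzero scalar \<open>2 \<mu>(v)\<close>.\<close>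
      then have "bracket K v = 0" if "K \<in> h" for K
        using v(2) that by (simp add: weight_space_def \<nu>_def)
      then have "v \<in> h"
        using h by (auto simp: cartan_subalgebra_def)
      then have va: "act v a = \<mu> v *s a" "act v a' = - \<mu> v *s a'"
        using a(1) a'(1) by (simp_all add: weight_vector_def)
      then have \<mu>v: "\<mu> v \<noteq> 0"
        using a(2) by auto
      have nz: "sp_prod a a \<noteq> 0" "sp_prod a' a' \<noteq> 0"
        using a(1) a'(1) by (simp_all add: sp_prod_self_nonzero weight_vector_def)
      have "\<mu> H + \<mu> H \<noteq> 0"
        using H True \<open>H \<in> h\<close> by (auto simp: eq_neg_iff_add_eq_0)
      then have "bracket v (sp_prod a a) = 0 \<or> bracket v (sp_prod a' a') = 0"
        using positive_system_cases[OF \<Phi> kill a(1) a(1) nz(1) a'(1) a'(1) \<open>H \<in> h\<close>] by blast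
      moreover have "bracket v (sp_prod a a) = (\<mu> v + \<mu> v) *\<^sub>C sp_prod a a"
          "bracket v (sp_prod a' a') = (- \<mu> v + - \<mu> v) *\<^sub>C sp_prod a' a'"
        by (simp_all only: bracket_sp_prod va sp_prod_linear cvec.scale_left_distrib)
      ultimately show False
        using \<mu>v nz by simp
    next
      case False
      then obtain K where K: "K \<in> h" "\<nu> K \<noteq> \<mu> K" by blast
      have ortho: "symp_form a b' = 0" "symp_form b a' = 0"
        using weights_of_paired_vectors[OF a(1) b'(1) _ K(1)] weights_of_paired_vectors[OF b a'(1) _ K(1)] K(2)
        by auto
      have "act (sp_prod a b) b' \<noteq> 0"
        using a b' ortho by (simp add: act_sp_prod weight_vector_def)
      then have nz: "sp_prod a b \<noteq> 0" by auto
      have "\<mu> H + \<nu> H \<noteq> 0"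
        using H by (auto simp: eq_neg_iff_add_eq_0 add.commute)
      then have "bracket v (sp_prod a b) = 0 \<or> bracket v (sp_prod a' b') = 0"
        using positive_system_cases[OF \<Phi> kill a(1) b nz a'(1) b'(1) \<open>H \<in> h\<close>] by blast
      then show False
      proof
        assume "bracket v (sp_prod a b) = 0"
        \<comment> \<open>Pairing with \<open>b'\<close> isolates the term \<open>bb\<close> of \<open>[v, ab] = bb + a(vb)\<close>.\<close>
        then have "symp_form (act (bracket v (sp_prod a b)) b') b' = 0" by simp
        then show False
          using b'(2) ortho
          unfolding bracket_sp_prod act_sp_linear act_sp_prod symp_form_linear b_def[symmetric] by simp
      next
        assume "bracket v (sp_prod a' b') = 0"
        \<comment> \<open>Pairing with \<open>a\<close> isolates the contribution of \<open>v b'\<close>, which pairs with \<open>a\<close> as \<open>b\<close> does with \<open>b'\<close>.\<close>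
        then have "symp_form (act (bracket v (sp_prod a' b')) a) a = 0" by simp
        moreover have "symp_form b' a = 0"
          using ortho symp_form_skew[of b' a] by simp
        moreover have "symp_form (act v b') a = - symp_form b' b"
          by (simp add: symp_form_act b_def)
        ultimately show False
          using a'(2) b'(2) symp_form_skew[of a a'] symp_form_skew[of b b']
          unfolding bracket_sp_prod act_sp_linear act_sp_prod symp_form_linear by simp
      qed
    qed
  qed
  then have "\<theta> H = 2 * \<nu> H" if "H \<in> h" for H
    using that by (fastforce simp: \<nu>_def algebra_simps eq_neg_iff_add_eq_0)
  then show thesis
    using that[of b b'] sp_prod_dual_in_cartan[OF b b'(1)] weight_of_sp_prod_dual[OF b b'(1)]
      b'(2) symp_form_skew[of b b'] by simp
qed

end


section \<open>The tensor square and its totally symmetric part\<close>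

lemma tensor_gen_add: "tensor_gen (x + y) = tensor_gen x + tensor_gen y"
proof transfer
  fix x y :: 'a
  have "free_gen (x + y) - free_gen x - free_gen y \<in> linearity_ideal"
    unfolding linearity_ideal_def by (rule ideal_generated_incl) (auto simp: linearity_relations_def)
  then show "tensor_rel (free_gen (x + y)) (free_gen x + free_gen y)"
    by (simp add: tensor_rel_def diff_diff_add)
qed

lemma tensor_gen_scale: "tensor_gen (c *\<^sub>C x) = c *\<^sub>C tensor_gen x"
proof transfer
  fix c and x :: 'a
  have "free_gen (c *\<^sub>C x) - free_const c * free_gen x \<in> linearity_ideal"
    unfolding linearity_ideal_def by (rule ideal_generated_incl) (auto simp: linearity_relations_def)
  then show "tensor_rel (free_gen (c *\<^sub>C x)) (free_const c * free_gen x)"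
    by (simp add: tensor_rel_def)
qed

lemma tensor_gen_zero: "tensor_gen 0 = 0"
  using tensor_gen_scale[of 0 0] by simp

lemma tensor_scale_mult:
  "(c *\<^sub>C s) * t = c *\<^sub>C (s * t)" "s * (c *\<^sub>C t) = c *\<^sub>C (s * t)" for s t :: "'a::complex_vector_space tensor_algebra"
proof -
  show "(c *\<^sub>C s) * t = c *\<^sub>C (s * t)"
    by transfer (simp add: mult.assoc equivp_reflp[OF equivp_tensor_rel])
  show "s * (c *\<^sub>C t) = c *\<^sub>C (s * t)"
  proof transfer
    fix s t :: "'a free_algebra" and c
    have "s * (free_const c * t) = free_const c * (s * t)"
      by (metis free_const_commute mult.assoc)
    then show "tensor_rel (s * (free_const c * t)) (free_const c * (s * t))"
      by (simp add: equivp_reflp[OF equivp_tensor_rel])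
  qed
qed

lemma tensor_action_add: "tensor_action Z (s + t) = tensor_action Z s + tensor_action Z t"
  by transfer (simp add: free_action_add equivp_reflp[OF equivp_tensor_rel])

lemma tensor_action_scale: "tensor_action Z (c *\<^sub>C t) = c *\<^sub>C tensor_action Z t"
  by transfer (simp add: free_action_mult equivp_reflp[OF equivp_tensor_rel])

lemma tensor_power_2: "tensor_power 2 = cvec.span {tensor_gen x * tensor_gen y | x y. True}"
proof -
  have "{prod_list (map tensor_gen xs) | xs. length xs = 2} = {tensor_gen x * tensor_gen y | x y :: 'a. True}"
  proof (intro set_eqI iffI)
    fix t :: "'a tensor_algebra"
    assume "t \<in> {tensor_gen x * tensor_gen y | x y. True}"
    then obtain x y where "t = tensor_gen x * tensor_gen y" by blast
    then show "t \<in> {prod_list (map tensor_gen xs) | xs. length xs = 2}"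
      by (intro CollectI exI[of _ "[x, y]"]) simp
  next
    fix t :: "'a tensor_algebra"
    assume "t \<in> {prod_list (map tensor_gen xs) | xs. length xs = 2}"
    then obtain xs :: "'a list" where xs: "t = prod_list (map tensor_gen xs)" "length xs = 2" by blast
    then obtain x y where "xs = [x, y]"
      by (auto simp: numeral_2_eq_2 length_Suc_conv)
    with xs show "t \<in> {tensor_gen x * tensor_gen y | x y. True}"
      by (intro CollectI exI[of _ x] exI[of _ y]) simp
  qed
  then show ?thesis
    by (simp add: tensor_power_def)
qed

definition sp_tensor ::
    "complex ^ ('n::finite + 'n) \<Rightarrow> complex ^ ('n + 'n) \<Rightarrow> complex ^ ('n + 'n) \<Rightarrow> complex ^ ('n + 'n) \<Rightarrow>
     'n sp tensor_algebra" where
  "sp_tensor a b c d = tensor_gen (sp_prod a b) * tensor_gen (sp_prod c d)"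

text \<open>Up to a scalar, the image of the monomial \<open>abcd\<close> under the embedding of the fourth symmetric power of \<open>V\<close>.\<close>

definition quartic ::
    "complex ^ ('n::finite + 'n) \<Rightarrow> complex ^ ('n + 'n) \<Rightarrow> complex ^ ('n + 'n) \<Rightarrow> complex ^ ('n + 'n) \<Rightarrow>
     'n sp tensor_algebra" where
  "quartic a b c d =
    sp_tensor a b c d + sp_tensor c d a b + sp_tensor a c b d + sp_tensor b d a c
    + sp_tensor a d b c + sp_tensor b c a d"

definition quadrilinear ::
    "(complex ^ 'm \<Rightarrow> complex ^ 'm \<Rightarrow> complex ^ 'm \<Rightarrow> complex ^ 'm \<Rightarrow> 'v::complex_vector_space) \<Rightarrow> bool" where
  "quadrilinear F \<longleftrightarrow>
    (\<forall>a b c d. Vector_Spaces.linear (*s) (*\<^sub>C) (\<lambda>x. F x b c d) \<and> Vector_Spaces.linear (*s) (*\<^sub>C) (\<lambda>x. F a x c d) \<and>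
      Vector_Spaces.linear (*s) (*\<^sub>C) (\<lambda>x. F a b x d) \<and> Vector_Spaces.linear (*s) (*\<^sub>C) (\<lambda>x. F a b c x))"

lemma linear_iff_add_scale:
  "Vector_Spaces.linear ((*s) :: complex \<Rightarrow> complex ^ 'm \<Rightarrow> _) ((*\<^sub>C) :: complex \<Rightarrow> 'v::complex_vector_space \<Rightarrow> _) f \<longleftrightarrow>
    (\<forall>x y. f (x + y) = f x + f y) \<and> (\<forall>c x. f (c *s x) = c *\<^sub>C f x)"
proof
  assume "Vector_Spaces.linear ((*s) :: complex \<Rightarrow> complex ^ 'm \<Rightarrow> _) (*\<^sub>C) f"
  then interpret f: Vector_Spaces.linear "(*s) :: complex \<Rightarrow> complex ^ 'm \<Rightarrow> _" "(*\<^sub>C)" f .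
  show "(\<forall>x y. f (x + y) = f x + f y) \<and> (\<forall>c x. f (c *s x) = c *\<^sub>C f x)"
    by (simp add: f.add f.scale)
qed (unfold_locales; simp)

lemma quadrilinearI:
  assumes "\<And>x y b c d. F (x + y) b c d = F x b c d + F y b c d" "\<And>k x b c d. F (k *s x) b c d = k *\<^sub>C F x b c d"
    and "\<And>a x y c d. F a (x + y) c d = F a x c d + F a y c d" "\<And>k a x c d. F a (k *s x) c d = k *\<^sub>C F a x c d"
    and "\<And>a b x y d. F a b (x + y) d = F a b x d + F a b y d" "\<And>k a b x d. F a b (k *s x) d = k *\<^sub>C F a b x d"
    and "\<And>a b c x y. F a b c (x + y) = F a b c x + F a b c y" "\<And>k a b c x. F a b c (k *s x) = k *\<^sub>C F a b c x"
  shows "quadrilinear F"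
  using assms by (simp add: quadrilinear_def linear_iff_add_scale)

lemma quadrilinearD:
  assumes "quadrilinear F"
  shows "F (x + y) b c d = F x b c d + F y b c d" "F (k *s x) b c d = k *\<^sub>C F x b c d"
    and "F a (x + y) c d = F a x c d + F a y c d" "F a (k *s x) c d = k *\<^sub>C F a x c d"
    and "F a b (x + y) d = F a b x d + F a b y d" "F a b (k *s x) d = k *\<^sub>C F a b x d"
    and "F a b c (x + y) = F a b c x + F a b c y" "F a b c (k *s x) = k *\<^sub>C F a b c x"
    and "F 0 b c d = 0" "F a 0 c d = 0" "F a b 0 d = 0" "F a b c 0 = 0"
proof -
  show *: "F (x + y) b c d = F x b c d + F y b c d" "F (k *s x) b c d = k *\<^sub>C F x b c d"
    "F a (x + y) c d = F a x c d + F a y c d" "F a (k *s x) c d = k *\<^sub>C F a x c d"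
    "F a b (x + y) d = F a b x d + F a b y d" "F a b (k *s x) d = k *\<^sub>C F a b x d"
    "F a b c (x + y) = F a b c x + F a b c y" "F a b c (k *s x) = k *\<^sub>C F a b c x" for a b c d x y k
    using assms by (simp_all add: quadrilinear_def linear_iff_add_scale)
  show "F 0 b c d = 0" "F a 0 c d = 0" "F a b 0 d = 0" "F a b c 0 = 0"
    using *(2)[of 0 0] *(4)[of _ 0 0] *(6)[of _ _ 0 0] *(8)[of _ _ _ 0 0] by simp_all
qed

lemma linear_in_subspace:
  assumes "Vector_Spaces.linear ((*s) :: complex \<Rightarrow> complex ^ 'm \<Rightarrow> _) (*\<^sub>C) f"
    and "cvec.subspace U" "\<And>x. x \<in> S \<Longrightarrow> f x \<in> U" "v \<in> vec.span S"
  shows "f v \<in> U"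
proof -
  interpret f: Vector_Spaces.linear "(*s) :: complex \<Rightarrow> complex ^ 'm \<Rightarrow> _" "(*\<^sub>C)" f
    by (rule assms)
  show ?thesis
    using assms(4)
    by (induction rule: vec.span_induct_alt)
      (simp_all add: f.zero f.add f.scale assms(2,3) cvec.subspace_0 cvec.subspace_add cvec.subspace_scale)
qed

text \<open>The form in which a spanning set of \<open>V\<close> is transported to tensors in four arguments.\<close>

lemma quadrilinear_in_subspace:
  assumes F: "quadrilinear F" and U: "cvec.subspace U" and S: "vec.span S = UNIV"
    and mem: "\<And>a b c d. a \<in> S \<Longrightarrow> b \<in> S \<Longrightarrow> c \<in> S \<Longrightarrow> d \<in> S \<Longrightarrow> F a b c d \<in> U"
  shows "F a b c d \<in> U"
proof -
  have 1: "F a b c d \<in> U" if "a \<in> S" "b \<in> S" "c \<in> S" for a b c d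
    by (rule linear_in_subspace[of "F a b c" U S]) (use F U S mem that in \<open>auto simp: quadrilinear_def\<close>)
  have 2: "F a b c d \<in> U" if "a \<in> S" "b \<in> S" for a b c d
    by (rule linear_in_subspace[of "\<lambda>x. F a b x d" U S]) (use F U S 1 that in \<open>auto simp: quadrilinear_def\<close>)
  have 3: "F a b c d \<in> U" if "a \<in> S" for a b c d
    by (rule linear_in_subspace[of "\<lambda>x. F a x c d" U S]) (use F U S 2 that in \<open>auto simp: quadrilinear_def\<close>)
  show ?thesis
    by (rule linear_in_subspace[of "\<lambda>x. F x b c d" U S]) (use F U S 3 in \<open>auto simp: quadrilinear_def\<close>)
qed

lemma quadrilinear_sp_tensor: "quadrilinear sp_tensor"
  by (rule quadrilinearI)
    (simp_all add: sp_tensor_def tensor_gen_add tensor_gen_scale tensor_scale_mult algebra_simps)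

lemma quadrilinear_quartic: "quadrilinear quartic"
  by (rule quadrilinearI)
    (simp_all add: quartic_def quadrilinearD[OF quadrilinear_sp_tensor] cvec.scale_right_distrib)

lemma sp_tensor_commute: "sp_tensor a b c d = sp_tensor b a c d" "sp_tensor a b c d = sp_tensor a b d c"
  by (simp_all add: sp_tensor_def sp_prod_commute)

lemma quartic_commute:
  "quartic a b c d = quartic b a c d" "quartic a b c d = quartic a c b d" "quartic a b c d = quartic a b d c"
  by (simp_all add: quartic_def sp_tensor_commute[of b a] sp_tensor_commute[of d c] sp_tensor_commute[of c b]
      sp_tensor_commute(2)[of _ _ b a] sp_tensor_commute(2)[of _ _ c b] sp_tensor_commute(2)[of _ _ d c] add_ac)

definition equivariant ::
    "(complex ^ ('n::finite + 'n) \<Rightarrow> complex ^ ('n + 'n) \<Rightarrow> complex ^ ('n + 'n) \<Rightarrow> complex ^ ('n + 'n) \<Rightarrow>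
      'n sp tensor_algebra) \<Rightarrow> bool" where
  "equivariant F \<longleftrightarrow> (\<forall>Z a b c d. tensor_action Z (F a b c d) =
    F (act Z a) b c d + F a (act Z b) c d + F a b (act Z c) d + F a b c (act Z d))"

lemma equivariant_sp_tensor: "equivariant sp_tensor"
  by (simp add: equivariant_def sp_tensor_def tensor_action_mult tensor_action_gen bracket_sp_prod
      tensor_gen_add algebra_simps)

lemma equivariant_quartic: "equivariant quartic"
  by (simp add: equivariant_def quartic_def tensor_action_add add_ac
      equivariant_sp_tensor[unfolded equivariant_def, rule_format])

lemma tensor_power_2_sp: "tensor_power 2 = cvec.span {sp_tensor a b c d | a b c d. True}" (is "_ = cvec.span ?Q")
proof
  have left: "tensor_gen X * tensor_gen (sp_prod c d) \<in> cvec.span ?Q" for X :: "'a sp" and c d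
  proof -
    have "X \<in> cvec.span {sp_prod a b | a b. True}"
      unfolding span_sp_prod by simp
    then show ?thesis
    proof (induction rule: cvec.span_induct_alt)
      case base
      then show ?case
        by (simp add: tensor_gen_zero cvec.span_zero)
    next
      case (step k x y)
      then obtain a b where "x = sp_prod a b" by blast
      then have "tensor_gen x * tensor_gen (sp_prod c d) \<in> cvec.span ?Q"
        by (intro cvec.span_base) (auto simp: sp_tensor_def)
      with step.IH show ?case
        by (simp add: tensor_gen_add tensor_gen_scale distrib_right tensor_scale_mult cvec.span_add cvec.span_scale)
    qed
  qed
  have "tensor_gen X * tensor_gen Y \<in> cvec.span ?Q" for X Y :: "'a sp"
  proof -
    have "Y \<in> cvec.span {sp_prod a b | a b. True}"
      unfolding span_sp_prod by simp
    then show ?thesis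
    proof (induction rule: cvec.span_induct_alt)
      case base
      then show ?case
        by (simp add: tensor_gen_zero cvec.span_zero)
    next
      case (step k x y)
      then have "tensor_gen X * tensor_gen x \<in> cvec.span ?Q"
        using left by blast
      with step.IH show ?case
        by (simp add: tensor_gen_add tensor_gen_scale distrib_left tensor_scale_mult cvec.span_add cvec.span_scale)
    qed
  qed
  then show "tensor_power 2 \<subseteq> cvec.span ?Q"
    unfolding tensor_power_2 by (intro cvec.span_minimal) auto
  show "cvec.span ?Q \<subseteq> tensor_power 2"
    unfolding tensor_power_2 by (rule cvec.span_mono) (auto simp: sp_tensor_def)
qed

definition quartics :: "'n::finite sp tensor_algebra set" where
  "quartics = cvec.span {quartic a b c d | a b c d. True}"

lemma quartic_in_quartics: "quartic a b c d \<in> quartics"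
  unfolding quartics_def by (rule cvec.span_base) blast

lemma sp_tensor_in_tensor_power: "sp_tensor a b c d \<in> tensor_power 2"
  unfolding tensor_power_2_sp by (rule cvec.span_base) blast

lemma equivariantD:
  assumes "equivariant F"
  shows "tensor_action Z (F a b c d) = F (act Z a) b c d + F a (act Z b) c d + F a b (act Z c) d + F a b c (act Z d)"
  using assms by (simp add: equivariant_def)

lemma tensor_action_zero [simp]: "tensor_action Z 0 = 0"
  using tensor_action_scale[of Z 0 0] by simp

lemma subspace_quartics: "cvec.subspace quartics"
  unfolding quartics_def by (rule cvec.subspace_span)

lemma submodule_quartics: "submodule tensor_action (quartics :: 'n::finite sp tensor_algebra set)"
proof -
  have "tensor_action Z t \<in> quartics" if "t \<in> quartics" for Z :: "'n sp" and t :: "'n sp tensor_algebra"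
    using that[unfolded quartics_def]
  proof (induction rule: cvec.span_induct_alt)
    case base
    then show ?case by (simp add: cvec.subspace_0 subspace_quartics)
  next
    case (step k x y)
    then obtain a b c d where "x = quartic a b c d" by blast
    then have "tensor_action Z x \<in> quartics"
      by (simp add: equivariantD[OF equivariant_quartic] cvec.subspace_add subspace_quartics quartic_in_quartics)
    with step.IH show ?case
      by (simp add: tensor_action_add tensor_action_scale cvec.subspace_add cvec.subspace_scale subspace_quartics)
  qed
  then show ?thesis
    by (simp add: submodule_def subspace_quartics)
qed

lemma hyperbolic_span:
  assumes "symp_form b' b \<noteq> 0"
  shows "vec.span ({b, b'} \<union> {v. symp_form b v = 0 \<and> symp_form b' v = 0}) = UNIV"
proof -
  have "v \<in> vec.span ({b, b'} \<union> {v. symp_form b v = 0 \<and> symp_form b' v = 0})" for v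
  proof -
    define r where "r = v - (symp_form b' v / symp_form b' b) *s b - (- symp_form b v / symp_form b' b) *s b'"
    have "symp_form b r = 0" "symp_form b' r = 0"
      using assms symp_form_skew[of b b'] unfolding r_def symp_form_linear by simp_all
    then have "(symp_form b' v / symp_form b' b) *s b + (- symp_form b v / symp_form b' b) *s b' + r
        \<in> vec.span ({b, b'} \<union> {v. symp_form b v = 0 \<and> symp_form b' v = 0})"
      by (intro vec.span_add vec.span_scale vec.span_base) simp_all
    then show ?thesis
      by (simp add: r_def)
  qed
  then show ?thesis by auto
qed

text \<open>For \<open>H = b b'\<close> the eigenvalues on \<open>V\<close> are \<open>k, -k, 0\<close>, so those on \<open>\<gg> \<otimes> \<gg>\<close> are \<open>k\<close> times a sum of four
  numbers from \<open>1, -1, 0\<close>. The highest weight vector of \<open>W\<close> has eigenvalue \<open>4 k\<close>, which only \<open>bb \<otimes> bb\<close>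
  attains. So \<open>W\<close> meets the symmetric tensors, and being irreducible it lies inside them.\<close>

lemma cartan_square_subset_quartics:
  fixes W :: "'n::finite sp tensor_algebra set"
  assumes W: "cartan_square W"
  shows "W \<subseteq> quartics"
proof -
  obtain h \<Phi> \<theta> where h: "cartan_subalgebra h" and \<Phi>: "positive_system h \<Phi>"
    and \<theta>: "has_highest_weight h \<Phi> bracket UNIV \<theta>"
    and hw: "has_highest_weight h \<Phi> tensor_action W (\<lambda>H. 2 * \<theta> H)"
    using W unfolding cartan_square_def by blast
  obtain b b' where b: "sp_prod b b' \<in> h" "symp_form b' b \<noteq> 0" "\<theta> (sp_prod b b') = 2 * symp_form b' b"
    using highest_root_is_long[OF h \<Phi> \<theta>] .
  define H where "H = sp_prod b b'"
  define k where "k = symp_form b' b"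
  obtain w where w: "w \<in> W" "w \<noteq> 0" "tensor_action H w = (4 * k) *\<^sub>C w"
    using hw b unfolding has_highest_weight_def weight_space_def H_def k_def by fastforce
  define S where "S = {b, b'} \<union> {v. symp_form b v = 0 \<and> symp_form b' v = 0}"
  define n :: "_ \<Rightarrow> int" where "n v = (if v = b then 1 else if v = b' then - 1 else 0)" for v
  have actH: "act H v = (k * of_int (n v)) *s v" if "v \<in> S" for v
    using that b(2) symp_form_skew[of b b'] by (auto simp: S_def n_def H_def k_def act_sp_prod)
  define m where "m = (\<lambda>(a, b, c, d). sp_tensor a b c d :: 'n sp tensor_algebra)"
  define f where "f = (\<lambda>(a, b, c, d). k * of_int (n a + n b + n c + n d))"
  define I where "I = S \<times> S \<times> S \<times> S"
  have "sp_tensor a b c d \<in> cvec.span (m ` I)" for a b c d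
  proof (rule quadrilinear_in_subspace[OF quadrilinear_sp_tensor cvec.subspace_span])
    show "vec.span S = UNIV"
      unfolding S_def by (rule hyperbolic_span[OF b(2)])
    show "sp_tensor a b c d \<in> cvec.span (m ` I)" if "a \<in> S" "b \<in> S" "c \<in> S" "d \<in> S" for a b c d
      by (rule cvec.span_base, rule image_eqI[of _ _ "(a, b, c, d)"]) (use that in \<open>simp_all add: m_def I_def\<close>)
  qed
  then have "tensor_power 2 \<subseteq> cvec.span (m ` I)"
    unfolding tensor_power_2_sp by (intro cvec.span_minimal) auto
  then have "w \<in> cvec.span (m ` I)"
    using W w(1) unfolding cartan_square_def by blast
  then have "w \<in> cvec.span (m ` {i \<in> I. f i = 4 * k})"
  proof (rule cvec.eigenvector_in_span_of_eigenvectors[of "tensor_action H", rotated 3])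
    fix i assume "i \<in> I"
    then show "tensor_action H (m i) = f i *\<^sub>C m i"
      by (auto simp: I_def m_def f_def actH equivariantD[OF equivariant_sp_tensor]
          quadrilinearD[OF quadrilinear_sp_tensor] distrib_left simp flip: cvec.scale_left_distrib)
  qed (simp_all add: w(3) tensor_action_add tensor_action_scale)
  moreover have "m ` {i \<in> I. f i = 4 * k} \<subseteq> {sp_tensor b b b b}"
  proof
    fix x assume "x \<in> m ` {i \<in> I. f i = 4 * k}"
    then obtain p q r s where x: "x = sp_tensor p q r s" "k * of_int (n p + n q + n r + n s) = 4 * k"
      by (auto simp: m_def f_def)
    then have "of_int (n p + n q + n r + n s) = (4 :: complex)"
      using b(2) unfolding k_def by (metis mult.commute mult_cancel_right)
    then have "n p + n q + n r + n s = 4"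
      by (metis of_int_eq_iff of_int_numeral)
    moreover have "n v \<le> 1" for v
      by (simp add: n_def)
    ultimately have "n p = 1" "n q = 1" "n r = 1" "n s = 1"
      by (smt (verit))+
    then show "x \<in> {sp_tensor b b b b}"
      by (simp add: x n_def split: if_splits)
  qed
  ultimately have "w \<in> cvec.span {sp_tensor b b b b}"
    using cvec.span_mono by blast
  then obtain e where "w = e *\<^sub>C sp_tensor b b b b"
    by (auto simp: cvec.span_singleton)
  also have "sp_tensor b b b b = (1/6) *\<^sub>C quartic b b b b"
  proof -
    have "(6 :: complex) = 1 + 1 + 1 + 1 + 1 + 1" by simp
    then have "quartic b b b b = 6 *\<^sub>C sp_tensor b b b b"
      unfolding quartic_def by (simp only: cvec.scale_left_distrib cvec.scale_one)
    then show ?thesis by simp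
  qed
  finally have "w \<in> quartics"
    using quartic_in_quartics[of b b b b] by (simp add: quartics_def cvec.span_scale)
  have irr: "irreducible_submodule tensor_action W"
    using W by (simp add: cartan_square_def)
  then have "submodule tensor_action (W \<inter> quartics)"
    using submodule_quartics by (auto simp: irreducible_submodule_def submodule_def intro: cvec.subspace_inter)
  moreover have "W \<inter> quartics \<noteq> {0}"
    using w \<open>w \<in> quartics\<close> by auto
  ultimately have "W \<inter> quartics = W"
    using irr unfolding irreducible_submodule_def by blast
  then show ?thesis by blast
qed

text \<open>The tensor \<open>uu \<otimes> vv\<close> (highest times lowest weight vector) generates \<open>\<gg> \<otimes> \<gg>\<close>. Concretely, the
  stabilizer of \<open>v\<close> moves \<open>uu\<close> to every \<open>ab\<close>, which settles the second factor \<open>vv\<close>; arbitrary elements then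
  move \<open>v\<close> anywhere.\<close>

lemma equivariant_quadrilinear_vanishes:
  assumes D: "quadrilinear D" "equivariant D"
    and sym: "\<And>a b c d. D a b c d = D b a c d" "\<And>a b c d. D a b c d = D a b d c"
    and uv: "symp_form v u \<noteq> 0" "D u u v v = 0"
  shows "D a b c d = 0"
proof -
  note lin = quadrilinearD[OF D(1)]
  have inv: "D (act Z a) b c d + D a (act Z b) c d + D a b (act Z c) d + D a b c (act Z d) = 0"
    if "D a b c d = 0" for Z a b c d
    using equivariantD[OF D(2), of Z a b c d] that by simp
  define \<kappa> where "\<kappa> = symp_form v u"
  have \<kappa>: "\<kappa> \<noteq> 0" using uv by (simp add: \<kappa>_def)
  have stab: "act (sp_prod v d) v = 0" if "symp_form d v = 0" for d
    using that by (simp add: act_sp_prod)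
  have act_u: "act (sp_prod v d) u = \<kappa> *s d + symp_form d u *s v" for d
    by (simp add: act_sp_prod \<kappa>_def)
  have double: "x + x = 0 \<longleftrightarrow> x = 0" for x :: "'a sp tensor_algebra"
  proof -
    have "x + x = 2 *\<^sub>C x"
      using cvec.scale_left_distrib[of 1 1 x] by simp
    then show ?thesis by (simp only: cvec.scale_eq_0_iff) simp
  qed
  have inv_v: "D (act (sp_prod v d) a) b v v + D a (act (sp_prod v d) b) v v = 0"
    if "D a b v v = 0" "symp_form d v = 0" for a b d
    using inv[OF that(1), of "sp_prod v d"] stab[OF that(2)] by (simp add: lin)
  have act_u_v: "act (sp_prod v v) u = (2 * \<kappa>) *s v"
    by (simp add: act_sp_prod_self \<kappa>_def)
  have vu: "D v u v v = 0"
    using inv_v[OF uv(2), of v] \<kappa> sym(1)[of u v v v] by (simp add: act_u_v lin double)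
  have du: "D d u v v = 0" if "symp_form d v = 0" for d
    using inv_v[OF uv(2) that] \<kappa> sym(1)[of u d v v] sym(1)[of u v v v] vu by (simp add: act_u lin double)
  have au: "D a u v v = 0" for a
  proof -
    define d where "d = a - (symp_form v a / \<kappa>) *s u"
    have "symp_form d v = 0"
      using \<kappa> symp_form_skew[of a v] symp_form_skew[of u v] by (simp add: d_def symp_form_linear \<kappa>_def)
    moreover have "a = d + (symp_form v a / \<kappa>) *s u"
      by (simp add: d_def)
    ultimately show ?thesis
      using du uv(2) by (metis add.right_neutral cvec.scale_zero_right lin(1,2))
  qed
  have av: "D a v v v = 0" for a
    using inv_v[OF au[of a], of v] au[of "act (sp_prod v v) a"] \<kappa> by (simp add: act_u_v lin)
  have ad: "D a d v v = 0" if "symp_form d v = 0" for a d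
    using inv_v[OF au[of a] that] au[of "act (sp_prod v d) a"] av[of a] \<kappa> by (simp add: act_u lin)
  have vv: "D a b v v = 0" for a b
  proof -
    define d where "d = b - (symp_form v b / \<kappa>) *s u"
    have "symp_form d v = 0"
      using \<kappa> symp_form_skew[of b v] symp_form_skew[of u v] by (simp add: d_def symp_form_linear \<kappa>_def)
    moreover have "b = d + (symp_form v b / \<kappa>) *s u"
      by (simp add: d_def)
    ultimately show ?thesis
      using ad au by (metis add.right_neutral cvec.scale_zero_right lin(3,4))
  qed
  have "v \<noteq> 0" using uv(1) by auto
  have cv: "D a b c v = 0" for a b c
  proof -
    obtain Z where "act Z v = c"
      using act_transitive[OF \<open>v \<noteq> 0\<close>] .
    then show ?thesis
      using inv[OF vv[of a b], of Z] vv sym(2)[of a b v c] by (simp add: double)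
  qed
  obtain Z where "act Z v = d"
    using act_transitive[OF \<open>v \<noteq> 0\<close>] .
  then show ?thesis
    using inv[OF cv[of a b c], of Z] by (simp add: cv)
qed


section \<open>The Cartan projection\<close>

definition axis_quartic :: "('n::finite + 'n) \<times> ('n + 'n) \<times> ('n + 'n) \<times> ('n + 'n) \<Rightarrow> 'n sp tensor_algebra" where
  "axis_quartic = (\<lambda>(a, b, c, d). quartic (axis a 1) (axis b 1) (axis c 1) (axis d 1))"

abbreviation index_tuples :: "'i set \<Rightarrow> ('i \<times> 'i \<times> 'i \<times> 'i) set" where
  "index_tuples J \<equiv> J \<times> J \<times> J \<times> J"

lemma quartics_eq_span_axis_quartics:
  "quartics = cvec.span (range (axis_quartic :: _ \<Rightarrow> 'n::finite sp tensor_algebra))"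
proof
  have "range (\<lambda>i. axis i 1 :: complex ^ ('n + 'n)) = cart_basis"
    by (auto simp: cart_basis_def)
  then have "vec.span (range (\<lambda>i. axis i 1 :: complex ^ ('n + 'n))) = UNIV"
    by (simp only: span_cart_basis)
  then have "quartic a b c d \<in> cvec.span (range axis_quartic)" for a b c d :: "complex ^ ('n + 'n)"
  proof (rule quadrilinear_in_subspace[OF quadrilinear_quartic cvec.subspace_span])
    fix a b c d :: "complex ^ ('n + 'n)"
    assume "a \<in> range (\<lambda>i. axis i 1)" "b \<in> range (\<lambda>i. axis i 1)" "c \<in> range (\<lambda>i. axis i 1)"
      "d \<in> range (\<lambda>i. axis i 1)"
    then obtain i j k l where "a = axis i 1" "b = axis j 1" "c = axis k 1" "d = axis l 1" by blast
    then have "quartic a b c d = axis_quartic (i, j, k, l)"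
      by (simp add: axis_quartic_def)
    then show "quartic a b c d \<in> cvec.span (range axis_quartic)"
      by (simp only: cvec.span_base rangeI)
  qed
  then show "quartics \<subseteq> cvec.span (range axis_quartic :: 'n sp tensor_algebra set)"
    unfolding quartics_def by (intro cvec.span_minimal) auto
  show "cvec.span (range axis_quartic :: 'n sp tensor_algebra set) \<subseteq> quartics"
    unfolding quartics_def by (rule cvec.span_mono) (auto simp: axis_quartic_def)
qed

definition occurrences :: "'i \<Rightarrow> 'i \<times> 'i \<times> 'i \<times> 'i \<Rightarrow> nat" where
  "occurrences p = (\<lambda>(a, b, c, d). (if a = p then 1 else 0) + (if b = p then 1 else 0)
    + (if c = p then 1 else 0) + (if d = p then 1 else 0))"

text \<open>On the monomial with \<open>p\<close> factors \<open>e\<^sub>k\<close> and \<open>q\<close> factors \<open>e\<^sub>l\<close>, raising and then lowering acts as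
  \<open>x\<^sub>l \<partial>\<^sub>k x\<^sub>k \<partial>\<^sub>l\<close>, with eigenvalue \<open>q (p + 1)\<close>.\<close>

lemma raising_lowering_axis_quartic:
  assumes "k \<noteq> l"
    and X: "\<And>i. act X (axis i 1) = (if i = l then \<alpha> *s axis k 1 else 0)"
    and Y: "\<And>i. act Y (axis i 1) = (if i = k then \<beta> *s axis l 1 else 0)"
  shows "tensor_action Y (tensor_action X (axis_quartic (a, b, c, d))) =
    (\<alpha> * \<beta> * of_nat (occurrences l (a, b, c, d) * (1 + occurrences k (a, b, c, d))))
      *\<^sub>C axis_quartic (a, b, c, d)"
  by (cases "a = k"; cases "a = l"; cases "b = k"; cases "b = l"; cases "c = k"; cases "c = l"; cases "d = k"; cases "d = l")
    (simp_all add: axis_quartic_def occurrences_def equivariantD[OF equivariant_quartic] X Y \<open>k \<noteq> l\<close> \<open>k \<noteq> l\<close>[symmetric]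
      quadrilinearD[OF quadrilinear_quartic] tensor_action_add tensor_action_scale quartic_commute
      flip: cvec.scale_left_distrib)

text \<open>The eigenvalue \<open>q (p + 1)\<close> vanishes only for \<open>q = 0\<close>, so a tensor killed by the raising operator involves
  no \<open>e\<^sub>l\<close>. This avoids diagonalizing a Casimir operator.\<close>

lemma eliminate_axis:
  assumes kl: "k \<noteq> l"
    and X: "\<And>i. act X (axis i 1) = (if i = l then \<alpha> *s axis k 1 else 0)"
    and Y: "\<And>i. act Y (axis i 1) = (if i = k then \<beta> *s axis l 1 else 0)"
    and nz: "\<alpha> \<noteq> 0" "\<beta> \<noteq> 0"
    and t: "t \<in> cvec.span (axis_quartic ` index_tuples J)" "tensor_action X t = 0"
  shows "t \<in> cvec.span (axis_quartic ` index_tuples (J - {l}))"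
proof -
  define f where "f i = \<alpha> * \<beta> * of_nat (occurrences l i * (1 + occurrences k i))" for i
  have "t \<in> cvec.span (axis_quartic ` {i \<in> index_tuples J. f i = 0})"
  proof (rule cvec.eigenvector_in_span_of_eigenvectors[of "\<lambda>t. tensor_action Y (tensor_action X t)"])
    fix i assume "i \<in> index_tuples J"
    then show "tensor_action Y (tensor_action X (axis_quartic i)) = f i *\<^sub>C axis_quartic i"
      using raising_lowering_axis_quartic[OF kl X Y] by (cases i) (simp only: f_def)
  qed (use t in \<open>simp_all add: tensor_action_add tensor_action_scale\<close>)
  also have "{i \<in> index_tuples J. f i = 0} \<subseteq> index_tuples (J - {l})"
    using nz by (auto simp: f_def occurrences_def simp del: of_nat_add of_nat_mult split: if_splits)
  then have "cvec.span (axis_quartic ` {i \<in> index_tuples J. f i = 0}) \<subseteq> cvec.span (axis_quartic ` index_tuples (J - {l}))"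
    by (intro cvec.span_mono image_mono)
  finally show ?thesis .
qed

lemma act_axis_squares:
  "act (sp_prod (axis (Inl j) 1) (axis (Inl j) 1)) (axis i 1) = (if i = Inr j then 2 *s axis (Inl j) 1 else 0)"
  "act (sp_prod (axis (Inr j) 1) (axis (Inr j) 1)) (axis i 1) = (if i = Inl j then (-2) *s axis (Inr j) 1 else 0)"
  by (simp_all only: act_sp_prod_self symp_form_axis) (simp_all add: axis_def)

text \<open>Invariance under the copies of \<open>\<ss>\<ll>\<^sub>2\<close> at all indices but \<open>i\<close> removes their coordinates; of the remaining
  binary quartics, only \<open>x\<^sup>2 y\<^sup>2\<close> has weight zero.\<close>

lemma torus_invariant_quartic:
  fixes t :: "'n::finite sp tensor_algebra"
  assumes t: "t \<in> quartics"
    and squares: "\<And>j. j \<noteq> i \<Longrightarrow> tensor_action (sp_prod (axis (Inl j) 1) (axis (Inl j) 1)) t = 0"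
      "\<And>j. j \<noteq> i \<Longrightarrow> tensor_action (sp_prod (axis (Inr j) 1) (axis (Inr j) 1)) t = 0"
    and torus: "tensor_action (sp_prod (axis (Inl i) 1) (axis (Inr i) 1)) t = 0"
  obtains c where "t = c *\<^sub>C quartic (axis (Inl i) 1) (axis (Inl i) 1) (axis (Inr i) 1) (axis (Inr i) 1)"
proof -
  have "t \<in> cvec.span (axis_quartic ` index_tuples (- (Inl ` A \<union> Inr ` A)))" if "finite A" "i \<notin> A" for A
    using that
  proof (induction A rule: finite_induct)
    case empty
    have "(UNIV :: (('n + 'n) \<times> ('n + 'n) \<times> ('n + 'n) \<times> ('n + 'n)) set) = index_tuples UNIV"
      by simp
    with t show ?case
      by (simp add: quartics_eq_span_axis_quartics)
  next
    case (insert j A)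
    let ?J = "- (Inl ` A \<union> Inr ` A) :: ('n + 'n) set"
    have "j \<noteq> i" using insert.prems by auto
    have "t \<in> cvec.span (axis_quartic ` index_tuples ?J)"
      using insert by simp
    then have "t \<in> cvec.span (axis_quartic ` index_tuples (?J - {Inr j}))"
      by (rule eliminate_axis[OF _ act_axis_squares(1) act_axis_squares(2) _ _ _ squares(1)[OF \<open>j \<noteq> i\<close>], rotated 3])
        simp_all
    then have "t \<in> cvec.span (axis_quartic ` index_tuples (?J - {Inr j} - {Inl j}))"
      by (rule eliminate_axis[OF _ act_axis_squares(2) act_axis_squares(1) _ _ _ squares(2)[OF \<open>j \<noteq> i\<close>], rotated 3])
        simp_all
    also have "?J - {Inr j} - {Inl j} = - (Inl ` insert j A \<union> Inr ` insert j A)"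
      by auto
    finally show ?case .
  qed
  from this[of "UNIV - {i}"]
  have "t \<in> cvec.span (axis_quartic ` index_tuples (- (Inl ` (UNIV - {i}) \<union> Inr ` (UNIV - {i}))))"
    by simp
  also have "- (Inl ` (UNIV - {i}) \<union> Inr ` (UNIV - {i})) = {Inl i, Inr i}"
  proof (rule set_eqI)
    fix p show "p \<in> - (Inl ` (UNIV - {i}) \<union> Inr ` (UNIV - {i})) \<longleftrightarrow> p \<in> {Inl i, Inr i}"
      by (cases p) auto
  qed
  finally have t': "t \<in> cvec.span (axis_quartic ` index_tuples {Inl i, Inr i})" .
  define n :: "'n + 'n \<Rightarrow> int" where "n p = (if p = Inr i then 1 else - 1)" for p
  define f :: "_ \<Rightarrow> complex" where "f = (\<lambda>(a, b, c, d). of_int (n a + n b + n c + n d))"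
  let ?H = "sp_prod (axis (Inl i) 1) (axis (Inr i) 1)"
  have actH: "act ?H (axis p 1) = of_int (n p) *s axis p 1" if "p \<in> {Inl i, Inr i}" for p
    using that by (auto simp: act_sp_prod symp_form_axis n_def) (simp_all add: axis_def)
  have "t \<in> cvec.span (axis_quartic ` {p \<in> index_tuples {Inl i, Inr i}. f p = 0})"
  proof (rule cvec.eigenvector_in_span_of_eigenvectors[of "tensor_action ?H"])
    fix p assume "p \<in> index_tuples {Inl i, Inr i}"
    then obtain a b c d where p: "p = (a, b, c, d)" "a \<in> {Inl i, Inr i}" "b \<in> {Inl i, Inr i}"
        "c \<in> {Inl i, Inr i}" "d \<in> {Inl i, Inr i}" by blast
    show "tensor_action ?H (axis_quartic p) = f p *\<^sub>C axis_quartic p"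
      by (simp add: p(1) axis_quartic_def f_def actH[OF p(2)] actH[OF p(3)] actH[OF p(4)] actH[OF p(5)]
          equivariantD[OF equivariant_quartic] quadrilinearD[OF quadrilinear_quartic] flip: cvec.scale_left_distrib)
  qed (use t' torus in \<open>simp_all add: tensor_action_add tensor_action_scale\<close>)
  also have "axis_quartic ` {p \<in> index_tuples {Inl i, Inr i}. f p = 0} \<subseteq>
      {quartic (axis (Inl i) 1) (axis (Inl i) 1) (axis (Inr i) 1) (axis (Inr i) 1)}"
    by (auto simp: f_def n_def axis_quartic_def quartic_commute simp flip: of_int_add)
  then have "cvec.span (axis_quartic ` {p \<in> index_tuples {Inl i, Inr i}. f p = 0}) \<subseteq>
      cvec.span {quartic (axis (Inl i) 1) (axis (Inl i) 1) (axis (Inr i) 1) (axis (Inr i) 1)}"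
    by (rule cvec.span_mono)
  finally show thesis
    using that by (auto simp: cvec.span_singleton)
qed

lemma projection_quadrilinear_equivariant:
  fixes P :: "'n::finite sp tensor_algebra \<Rightarrow> 'n sp tensor_algebra"
  assumes P: "cartan_projection P"
  shows "quadrilinear (\<lambda>a b c d. P (sp_tensor a b c d))" "equivariant (\<lambda>a b c d. P (sp_tensor a b c d))"
proof -
  have add: "P (s + t) = P s + P t" if "s \<in> tensor_power 2" "t \<in> tensor_power 2" for s t
    using P that by (simp add: cartan_projection_def)
  have scale: "P (c *\<^sub>C t) = c *\<^sub>C P t" if "t \<in> tensor_power 2" for c t
    using P that by (simp add: cartan_projection_def)
  have sub: "s + t \<in> tensor_power 2" if "s \<in> tensor_power 2" "t \<in> tensor_power 2" for s t :: "'n sp tensor_algebra"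
    using that by (simp add: tensor_power_2_sp cvec.span_add)
  show "quadrilinear (\<lambda>a b c d. P (sp_tensor a b c d))"
    by (rule quadrilinearI)
      (simp_all add: quadrilinearD[OF quadrilinear_sp_tensor] add scale sp_tensor_in_tensor_power)
  have "tensor_action Z (P (sp_tensor a b c d)) = P (tensor_action Z (sp_tensor a b c d))" for Z a b c d
    using P by (simp add: cartan_projection_def sp_tensor_in_tensor_power)
  then show "equivariant (\<lambda>a b c d. P (sp_tensor a b c d))"
    by (simp add: equivariant_def equivariantD[OF equivariant_sp_tensor] add sub sp_tensor_in_tensor_power)
qed

text \<open>The projection and \<open>quartic\<close> are equivariant and, after scaling, agree on the generating tensor
  \<open>xx \<otimes> yy\<close>. The scalar \<open>k\<close> is immaterial: only the symmetry of the right-hand side matters.\<close>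

lemma projection_eq_quartic:
  fixes P :: "'n::finite sp tensor_algebra \<Rightarrow> 'n sp tensor_algebra"
  assumes P: "cartan_projection P"
  obtains k where "\<And>a b c d. P (sp_tensor a b c d) = k *\<^sub>C quartic a b c d"
proof -
  obtain i :: 'n where True by simp
  let ?x = "axis (Inl i) 1 :: complex ^ ('n + 'n)" and ?y = "axis (Inr i) 1 :: complex ^ ('n + 'n)"
  note lin = quadrilinearD[OF projection_quadrilinear_equivariant(1)[OF P]]
  note equi = equivariantD[OF projection_quadrilinear_equivariant(2)[OF P]]
  have "cartan_square (P ` tensor_power 2)"
    using P by (auto simp: cartan_projection_def)
  then have "P ` tensor_power 2 \<subseteq> quartics"
    by (rule cartan_square_subset_quartics)
  then have "P (sp_tensor ?x ?x ?y ?y) \<in> quartics"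
    using sp_tensor_in_tensor_power by blast
  moreover have "tensor_action (sp_prod (axis (Inl j) 1) (axis (Inl j) 1)) (P (sp_tensor ?x ?x ?y ?y)) = 0"
      "tensor_action (sp_prod (axis (Inr j) 1) (axis (Inr j) 1)) (P (sp_tensor ?x ?x ?y ?y)) = 0" if "j \<noteq> i" for j
    using that by (simp_all add: equi act_axis_squares lin)
  moreover have "tensor_action (sp_prod ?x ?y) (P (sp_tensor ?x ?x ?y ?y)) = 0"
  proof -
    have "act (sp_prod ?x ?y) ?x = (- 1) *s ?x" "act (sp_prod ?x ?y) ?y = 1 *s ?y"
      by (simp_all add: act_sp_prod symp_form_axis)
    then show ?thesis
      by (simp only: equi lin) simp
  qed
  ultimately obtain k where k: "P (sp_tensor ?x ?x ?y ?y) = k *\<^sub>C quartic ?x ?x ?y ?y"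
    by (rule torus_invariant_quartic[of _ i])
  \<comment> \<open>The difference is equivariant and vanishes on a generating tensor.\<close>
  define D where "D = (\<lambda>a b c d. P (sp_tensor a b c d) - k *\<^sub>C quartic a b c d)"
  have "D a b c d = 0" for a b c d
  proof (rule equivariant_quadrilinear_vanishes[of D ?y ?x])
    show "quadrilinear D"
      by (rule quadrilinearI)
        (simp_all add: D_def lin quadrilinearD[OF quadrilinear_quartic] algebra_simps cvec.scale_right_distrib
          cvec.scale_right_diff_distrib)
    have diff: "tensor_action Z (s - t) = tensor_action Z s - tensor_action Z t" for Z :: "'n sp" and s t
      using tensor_action_add[of Z s "(- 1) *\<^sub>C t"] by (simp only: tensor_action_scale) simp
    show "equivariant D"
      by (simp add: equivariant_def D_def diff tensor_action_scale equi equivariantD[OF equivariant_quartic]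
          cvec.scale_right_distrib)
    show "D a b c d = D b a c d" "D a b c d = D a b d c" for a b c d
      by (simp_all add: D_def sp_tensor_commute[of a b] sp_tensor_commute(2)[of _ _ c d] quartic_commute(1)[of a b] quartic_commute(3)[of _ _ c d])
    show "symp_form ?y ?x \<noteq> 0"
      by (simp add: symp_form_axis)
    show "D ?x ?x ?y ?y = 0"
      by (simp add: D_def k)
  qed
  then show thesis
    using that[of k] by (simp add: D_def)
qed

lemma projection_symmetric:
  fixes P :: "'n::finite sp tensor_algebra \<Rightarrow> 'n sp tensor_algebra"
  assumes P: "cartan_projection P"
  shows "P (sp_tensor a b c d) = P (sp_tensor b a c d)" "P (sp_tensor a b c d) = P (sp_tensor a c b d)"
    "P (sp_tensor a b c d) = P (sp_tensor a b d c)"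
proof -
  obtain k where k: "\<And>a b c d. P (sp_tensor a b c d) = k *\<^sub>C quartic a b c d"
    using projection_eq_quartic[OF P] by blast
  show "P (sp_tensor a b c d) = P (sp_tensor b a c d)"
    unfolding k by (simp only: quartic_commute(1)[of a b c d])
  show "P (sp_tensor a b c d) = P (sp_tensor a c b d)"
    unfolding k by (simp only: quartic_commute(2)[of a b c d])
  show "P (sp_tensor a b c d) = P (sp_tensor a b d c)"
    unfolding k by (simp only: quartic_commute(3)[of a b c d])
qed


section \<open>The quotient by the ideal\<close>

lemma ideal_add_cancel: "two_sided_ideal I \<Longrightarrow> x \<in> I \<Longrightarrow> x + y \<in> I \<Longrightarrow> y \<in> I"
  using ideal_diff[of I "x + y" x] by simp

lemma ideal_scale:
  fixes I :: "'a::complex_vector_space tensor_algebra set"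
  assumes "two_sided_ideal I" "t \<in> I"
  shows "c *\<^sub>C t \<in> I"
  using ideal_mult_left[OF assms, of "c *\<^sub>C 1"] by (simp add: tensor_scale_mult)

lemma subspace_ideal:
  fixes I :: "'a::complex_vector_space tensor_algebra set"
  shows "two_sided_ideal I \<Longrightarrow> cvec.subspace I"
  by (simp add: cvec.subspace_def ideal_zero ideal_add ideal_scale)

lemma ideal_scale_cancel:
  fixes I :: "'a::complex_vector_space tensor_algebra set"
  assumes "two_sided_ideal I" "c *\<^sub>C t \<in> I" "c \<noteq> 0"
  shows "t \<in> I"
  using ideal_scale[OF assms(1,2), of "inverse c"] assms(3) by simp

text \<open>Modulo \<open>I\<close>, the elements \<open>p\<close> and \<open>q\<close> generate a Heisenberg algebra with central \<open>z\<close>, and \<open>X, Y, H\<close> are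
  its quadratic elements divided by \<open>z\<close>. With \<open>u = pq\<close> and \<open>v = qp = u - z\<close> one finds
  \<open>2 p\<^sup>2 q\<^sup>2 + 2 q\<^sup>2 p\<^sup>2 - (u + v)\<^sup>2 = (u - v)\<^sup>2 + 2 z\<^sup>2 = 3 z\<^sup>2\<close>, which is twice \<open>z\<^sup>2\<close> times the Casimir
  element. Each step is written as an explicit combination of the given elements of \<open>I\<close>.\<close>

lemma oscillator_casimir:
  fixes I :: "'r::ring_1 set"
  assumes I: "two_sided_ideal I"
    and comm: "z * X - X * z \<in> I" "z * Y - Y * z \<in> I" "z * H - H * z \<in> I"
      "z * p - p * z \<in> I" "z * q - q * z \<in> I"
    and quad: "X * z - p * p \<in> I" "Y * z - q * q \<in> I" "H * z + H * z - (p * q + q * p) \<in> I"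
    and heis: "p * q - q * p - z \<in> I"
    and cas: "X * Y + Y * X - (H * H + H * H) - C \<in> I"
  shows "z * z * (C + C) - (z * z + z * z + z * z) \<in> I"
proof -
  note [intro] = ideal_add[OF I] ideal_diff[OF I] ideal_mult_left[OF I] ideal_mult_right[OF I] ideal_uminus[OF I]
  have move: "z * z * (A * B) - A * z * (B * z) \<in> I" if "z * A - A * z \<in> I" "z * B - B * z \<in> I" for A B
  proof -
    have "z * z * (A * B) - A * z * (B * z) =
        z * ((z * A - A * z) * B) + (z * A - A * z) * (z * B) + A * z * (z * B - B * z)"
      by (simp add: algebra_simps)
    also have "\<dots> \<in> I" using that by blast
    finally show ?thesis .
  qed
  let ?u = "p * q" and ?v = "q * p"
  have XY: "z * z * (X * Y) - (?u * ?u + z * ?u) \<in> I"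
  proof -
    have "z * z * (X * Y) - (?u * ?u + z * ?u) = (z * z * (X * Y) - X * z * (Y * z))
        + (X * z - p * p) * (Y * z) + p * p * (Y * z - q * q) + p * ((p * q - q * p - z) * q) - (z * p - p * z) * q"
      by (simp add: algebra_simps)
    also have "\<dots> \<in> I" using comm quad heis move[of X Y] by blast
    finally show ?thesis .
  qed
  have YX: "z * z * (Y * X) - (?v * ?v - z * ?v) \<in> I"
  proof -
    have "z * z * (Y * X) - (?v * ?v - z * ?v) = (z * z * (Y * X) - Y * z * (X * z))
        + (Y * z - q * q) * (X * z) + q * q * (X * z - p * p) - q * ((p * q - q * p - z) * p) + (z * q - q * z) * p"
      by (simp add: algebra_simps)
    also have "\<dots> \<in> I" using comm quad heis move[of Y X] by blast
    finally show ?thesis .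
  qed
  have HH: "z * z * (H * H) + z * z * (H * H) + z * z * (H * H) + z * z * (H * H) - (?u + ?v) * (?u + ?v) \<in> I"
  proof -
    have "z * z * (H * H) + z * z * (H * H) + z * z * (H * H) + z * z * (H * H) - (?u + ?v) * (?u + ?v) =
        (z * z * (H * H) - H * z * (H * z)) + (z * z * (H * H) - H * z * (H * z))
        + (z * z * (H * H) - H * z * (H * z)) + (z * z * (H * H) - H * z * (H * z))
        + (H * z + H * z - (?u + ?v)) * (H * z + H * z) + (?u + ?v) * (H * z + H * z - (?u + ?v))"
      by (simp add: algebra_simps)
    also have "\<dots> \<in> I" using comm quad move[of H H] by blast
    finally show ?thesis .
  qed
  define d where "d = ?u - ?v - z"
  define e where "e = X * Y + Y * X - (H * H + H * H) - C"
  have "z * z * (C + C) - (z * z + z * z + z * z) =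
      (z * z * (X * Y) - (?u * ?u + z * ?u)) + (z * z * (X * Y) - (?u * ?u + z * ?u))
      + (z * z * (Y * X) - (?v * ?v - z * ?v)) + (z * z * (Y * X) - (?v * ?v - z * ?v))
      - (z * z * (H * H) + z * z * (H * H) + z * z * (H * H) + z * z * (H * H) - (?u + ?v) * (?u + ?v))
      - z * z * (e + e) + (d * d + d * z + z * d + z * d + z * d)"
    by (simp add: algebra_simps d_def e_def)
  also have "\<dots> \<in> I"
    using XY YX HH cas heis unfolding d_def[symmetric] e_def[symmetric] by blast
  finally show ?thesis .
qed

text \<open>The fourth power of one vector generates all quartics: replace the arguments \<open>z\<close> one after the other.\<close>

lemma symmetric_orbit_in_subspace:
  fixes F :: "complex ^ ('n::finite + 'n) \<Rightarrow> complex ^ ('n + 'n) \<Rightarrow> complex ^ ('n + 'n) \<Rightarrow> complex ^ ('n + 'n) \<Rightarrow> 'v::complex_vector_space"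
  assumes U: "cvec.subspace U"
    and sym: "\<And>a b c d. F a b c d = F b a c d" "\<And>a b c d. F a b c d = F a c b d" "\<And>a b c d. F a b c d = F a b d c"
    and inv: "\<And>Z a b c d. F a b c d \<in> U \<Longrightarrow>
      F (act Z a) b c d + F a (act Z b) c d + F a b (act Z c) d + F a b c (act Z d) \<in> U"
    and z: "z \<noteq> 0" "F z z z z \<in> U"
  shows "F a b c d \<in> U"
proof -
  have cancel: "y \<in> U" if "x \<in> U" "x + y \<in> U" for x y
    using cvec.subspace_diff[OF U that(2,1)] by simp
  have halve: "x \<in> U" if "x + x \<in> U" for x
  proof -
    have "x = (1/2) *\<^sub>C (x + x)"
      by (simp add: cvec.scale_right_distrib flip: cvec.scale_left_distrib)
    then show ?thesis
      using cvec.subspace_scale[OF U that] by metis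
  qed
  have third: "x \<in> U" if "x + x + x \<in> U" for x
  proof -
    have "x = (1/3) *\<^sub>C (x + x + x)"
      by (simp add: cvec.scale_right_distrib flip: cvec.scale_left_distrib)
    then show ?thesis
      using cvec.subspace_scale[OF U that] by metis
  qed
  have 1: "F a z z z \<in> U" for a
  proof -
    obtain Z where Z: "act Z z = a"
      using act_transitive[OF z(1)] .
    have "F a z z z + F z a z z + F z z a z + F z z z a \<in> U"
      using inv[OF z(2), of Z] by (simp only: Z)
    moreover have "F z a z z = F a z z z" "F z z a z = F a z z z" "F z z z a = F a z z z"
      using sym by metis+
    ultimately have "(F a z z z + F a z z z) + (F a z z z + F a z z z) \<in> U"
      by (simp add: add.assoc)
    then show ?thesis by (blast dest: halve)
  qed
  \<comment> \<open>The term in which \<open>Z\<close> hits \<open>a\<close> is covered by the previous step; the others coincide by symmetry.\<close>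
  have 2: "F a b z z \<in> U" for a b
  proof -
    obtain Z where Z: "act Z z = b"
      using act_transitive[OF z(1)] .
    have "F (act Z a) z z z + (F a b z z + F a z b z + F a z z b) \<in> U"
      using inv[OF 1[of a], of Z] by (simp only: Z add.assoc)
    moreover have "F a z b z = F a b z z" "F a z z b = F a b z z"
      using sym by metis+
    ultimately show ?thesis
      using cancel[OF 1] third by metis
  qed
  have 3: "F a b c z \<in> U" for a b c
  proof -
    obtain Z where Z: "act Z z = c"
      using act_transitive[OF z(1)] .
    have "F (act Z a) b z z + (F a (act Z b) z z + (F a b c z + F a b z c)) \<in> U"
      using inv[OF 2[of a b], of Z] by (simp only: Z add.assoc)
    moreover have "F a b z c = F a b c z"
      using sym by metis
    ultimately show ?thesis
      using cancel[OF 2] halve by metis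
  qed
  obtain Z where Z: "act Z z = d"
    using act_transitive[OF z(1)] .
  have "F (act Z a) b c z + (F a (act Z b) c z + (F a b (act Z c) z + F a b c d)) \<in> U"
    using inv[OF 3[of a b c], of Z] by (simp only: Z add.assoc)
  then show ?thesis
    using cancel[OF 3] by blast
qed

lemma killing_sp_prod_commute: "killing (sp_prod a b) (sp_prod c d) = killing (sp_prod c d) (sp_prod a b)"
  by (simp add: killing_sp_prod symp_form_skew[of c] symp_form_skew[of d] algebra_simps)

text \<open>The properties of the relations that the argument in the quotient uses; \<open>\<sigma> a b c d\<close> stands for
  \<open>ab \<circledcirc> cd\<close>.\<close>

locale symplectic_relations =
  fixes I :: "'n::finite sp tensor_algebra set" and lam :: complex
    and \<sigma> :: "complex ^ ('n + 'n) \<Rightarrow> complex ^ ('n + 'n) \<Rightarrow> complex ^ ('n + 'n) \<Rightarrow> complex ^ ('n + 'n) \<Rightarrow>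
      'n sp tensor_algebra"
  assumes ideal: "two_sided_ideal I"
    and relation: "\<And>a b c d. tensor_gen (sp_prod a b) * tensor_gen (sp_prod c d) - \<sigma> a b c d
      - (1/2) *\<^sub>C tensor_gen (bracket (sp_prod a b) (sp_prod c d))
      - (lam * killing (sp_prod a b) (sp_prod c d)) *\<^sub>C 1 \<in> I"
    and symmetric: "\<And>a b c d. \<sigma> a b c d = \<sigma> b a c d" "\<And>a b c d. \<sigma> a b c d = \<sigma> a c b d"
      "\<And>a b c d. \<sigma> a b c d = \<sigma> a b d c"
    and quadratic: "\<And>a b c d. \<sigma> a b c d \<in> tensor_power 2"
    and equivariant: "equivariant \<sigma>"
begin

definition gen :: "complex ^ ('n + 'n) \<Rightarrow> complex ^ ('n + 'n) \<Rightarrow> 'n sp tensor_algebra" where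
  "gen a b = tensor_gen (sp_prod a b)"

definition gen_bracket :: "complex ^ ('n + 'n) \<Rightarrow> complex ^ ('n + 'n) \<Rightarrow> complex ^ ('n + 'n) \<Rightarrow> complex ^ ('n + 'n) \<Rightarrow>
    'n sp tensor_algebra" where
  "gen_bracket a b c d = tensor_gen (bracket (sp_prod a b) (sp_prod c d))"

lemma rel: "gen a b * gen c d - \<sigma> a b c d - (1/2) *\<^sub>C gen_bracket a b c d
    - (lam * killing (sp_prod a b) (sp_prod c d :: 'n sp)) *\<^sub>C 1 \<in> I"
  unfolding gen_def gen_bracket_def by (rule relation)

lemma \<sigma>_swap: "\<sigma> c d a b = \<sigma> a b c d"
  by (metis symmetric)

lemma gen_bracket: "gen_bracket a b c d = gen (act (sp_prod a b) c) d + gen c (act (sp_prod a b) d)"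
  by (simp add: gen_bracket_def bracket_sp_prod tensor_gen_add gen_def)

lemma gen_bracket_swap: "gen_bracket c d a b = - gen_bracket a b c d"
  using tensor_gen_scale[of "-1" "bracket (sp_prod a b) (sp_prod c d)"]
  by (simp add: gen_bracket_def bracket_skew[of "sp_prod c d"])

lemma gen_linear: "gen (- a) b = - gen a b" "gen a (- b) = - gen a b" "gen 0 b = 0" "gen a 0 = 0"
  using tensor_gen_scale[of "-1" "sp_prod a b"] sp_prod_linear(5)[of "-1" a b] sp_prod_linear(6)[of a "-1" b]
  by (simp_all add: gen_def tensor_gen_zero)

lemma gen_commute: "gen a b = gen b a"
  by (simp add: gen_def sp_prod_commute)

lemma commutator_gen: "gen a b * gen c d - gen c d * gen a b - gen_bracket a b c d \<in> I"
proof -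
  let ?r = "\<lambda>a b c d. gen a b * gen c d - \<sigma> a b c d - (1/2) *\<^sub>C gen_bracket a b c d
    - (lam * killing (sp_prod a b) (sp_prod c d :: 'n sp)) *\<^sub>C 1"
  have "?r a b c d - ?r c d a b =
      gen a b * gen c d - gen c d * gen a b - ((1/2) *\<^sub>C gen_bracket a b c d + (1/2) *\<^sub>C gen_bracket a b c d)"
    by (simp add: \<sigma>_swap[of c d a b] gen_bracket_swap[of c d a b] killing_sp_prod_commute[of c d])
  also have "(1/2) *\<^sub>C gen_bracket a b c d + (1/2) *\<^sub>C gen_bracket a b c d = gen_bracket a b c d"
    by (simp flip: cvec.scale_left_distrib)
  finally show ?thesis
    using ideal_diff[OF ideal rel rel] by metis
qed

lemma commutator: "tensor_gen Z * gen c d - gen c d * tensor_gen Z - tensor_gen (bracket Z (sp_prod c d)) \<in> I"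
proof -
  have "Z \<in> cvec.span {sp_prod a b | a b. True}"
    unfolding span_sp_prod by simp
  then show ?thesis
  proof (induction rule: cvec.span_induct_alt)
    case base
    have "bracket 0 (sp_prod c d) = 0"
      using bracket_scale_left[of 0 0 "sp_prod c d"] by simp
    then show ?case by (simp add: tensor_gen_zero ideal_zero[OF ideal])
  next
    case (step k x y)
    let ?c = "\<lambda>x. tensor_gen x * gen c d - gen c d * tensor_gen x - tensor_gen (bracket x (sp_prod c d))"
    obtain a b where "x = sp_prod a b"
      using step.hyps by blast
    then have "?c x \<in> I"
      using commutator_gen[of a b c d] by (simp add: gen_def gen_bracket_def)
    then have "k *\<^sub>C ?c x + ?c y \<in> I"
      using step.IH by (intro ideal_add[OF ideal] ideal_scale[OF ideal])
    moreover have "k *\<^sub>C ?c x + ?c y = ?c (k *\<^sub>C x + y)"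
      by (simp add: tensor_gen_add tensor_gen_scale bracket_add_left bracket_scale_left tensor_scale_mult
          cvec.scale_right_diff_distrib algebra_simps)
    ultimately show ?case by simp
  qed
qed

text \<open>In the quotient, \<open>\<gg>\<close> acts by commutators. Hence the part of \<open>I\<close> in degree two is stable under the action.\<close>

lemma action_eq_commutator:
  assumes "t \<in> tensor_power 2"
  shows "tensor_action Z t - (tensor_gen Z * t - t * tensor_gen Z) \<in> I"
  using assms unfolding tensor_power_2_sp
proof (induction rule: cvec.span_induct_alt)
  case base
  then show ?case by (simp add: ideal_zero[OF ideal])
next
  case (step k s t)
  let ?c = "\<lambda>s. tensor_action Z s - (tensor_gen Z * s - s * tensor_gen Z)"
  obtain a b c d where s: "s = gen a b * gen c d"
    using step.hyps by (auto simp: sp_tensor_def gen_def)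
  define e1 where "e1 = tensor_gen Z * gen a b - gen a b * tensor_gen Z - tensor_gen (bracket Z (sp_prod a b))"
  define e2 where "e2 = tensor_gen Z * gen c d - gen c d * tensor_gen Z - tensor_gen (bracket Z (sp_prod c d))"
  have eq: "?c s = - (e1 * gen c d + gen a b * e2)"
    by (simp add: s e1_def e2_def tensor_action_mult tensor_action_gen gen_def algebra_simps)
  have "e1 \<in> I" "e2 \<in> I"
    unfolding e1_def e2_def by (rule commutator)+
  then have "?c s \<in> I"
    unfolding eq
    by (intro ideal_uminus[OF ideal] ideal_add[OF ideal] ideal_mult_right[OF ideal, of e1] ideal_mult_left[OF ideal, of e2])
  then have "k *\<^sub>C ?c s + ?c t \<in> I"
    using step.IH by (intro ideal_add[OF ideal] ideal_scale[OF ideal])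
  moreover have "k *\<^sub>C ?c s + ?c t = ?c (k *\<^sub>C s + t)"
    by (simp add: tensor_action_add tensor_action_scale tensor_scale_mult cvec.scale_right_diff_distrib algebra_simps)
  ultimately show ?case by simp
qed

lemma \<sigma>_invariant:
  assumes "\<sigma> a b c d \<in> I"
  shows "\<sigma> (act Z a) b c d + \<sigma> a (act Z b) c d + \<sigma> a b (act Z c) d + \<sigma> a b c (act Z d) \<in> I"
proof -
  have "tensor_gen Z * \<sigma> a b c d - \<sigma> a b c d * tensor_gen Z \<in> I"
    using ideal_diff[OF ideal ideal_mult_left[OF ideal assms] ideal_mult_right[OF ideal assms]] .
  then have "tensor_action Z (\<sigma> a b c d) \<in> I"
    using ideal_add[OF ideal action_eq_commutator[OF quadratic]] by (metis diff_add_cancel)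
  then show ?thesis
    by (simp add: equivariantD[OF equivariant])
qed

lemma gen_invariant:
  assumes "gen a b \<in> I"
  shows "gen (act Z a) b + gen a (act Z b) \<in> I"
proof -
  have "tensor_gen Z * gen a b - gen a b * tensor_gen Z \<in> I"
    using ideal_diff[OF ideal ideal_mult_left[OF ideal assms] ideal_mult_right[OF ideal assms]] .
  from ideal_diff[OF ideal this commutator[of Z a b]] show ?thesis
    by (simp add: bracket_sp_prod tensor_gen_add gen_def add.commute)
qed

context
  fixes x y z t :: "complex ^ ('n + 'n)"
  assumes \<omega>: "symp_form x y = 1" "symp_form z t = 1"
    "symp_form x z = 0" "symp_form x t = 0" "symp_form y z = 0" "symp_form y t = 0"
begin

lemma \<omega>': "symp_form y x = - 1" "symp_form t z = - 1"
    "symp_form z x = 0" "symp_form t x = 0" "symp_form z y = 0" "symp_form t y = 0"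
  using \<omega> symp_form_skew[of y x] symp_form_skew[of t z] symp_form_skew[of z x] symp_form_skew[of t x]
    symp_form_skew[of z y] symp_form_skew[of t y] by simp_all

lemmas eval = gen_bracket killing_sp_prod act_sp_prod \<omega> \<omega>' gen_linear

lemma z_nonzero: "z \<noteq> 0"
  using \<omega>(2) by auto

text \<open>The Casimir value \<open>c = - 24 (n + 1) \<lambda>\<close> follows from the Killing form; compared with the oscillator
  value \<open>3/2\<close>, the difference is multiplied by \<open>(zz)\<^sup>2\<close>.\<close>

lemma casimir_times_square:
  "(- 48 * (of_nat CARD('n) + 1) * lam - 3) *\<^sub>C (gen z z * gen z z) \<in> I"
proof -
  define c where "c = - 24 * (of_nat CARD('n) + 1) * lam"
  have "gen z z * gen z z * (c *\<^sub>C 1 + c *\<^sub>C 1) - (gen z z * gen z z + gen z z * gen z z + gen z z * gen z z) \<in> I"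
  proof (rule oscillator_casimir[OF ideal, of "gen z z" "gen x x" "gen y y" "gen x y" "gen x z" "gen y z"])
    show "gen z z * gen x x - gen x x * gen z z \<in> I" "gen z z * gen y y - gen y y * gen z z \<in> I"
      "gen z z * gen x y - gen x y * gen z z \<in> I" "gen z z * gen x z - gen x z * gen z z \<in> I"
      "gen z z * gen y z - gen y z * gen z z \<in> I"
      using commutator_gen[of z z x x] commutator_gen[of z z y y] commutator_gen[of z z x y]
        commutator_gen[of z z x z] commutator_gen[of z z y z]
      by (simp_all add: eval)
    show "gen x z * gen y z - gen y z * gen x z - gen z z \<in> I"
      using commutator_gen[of x z y z] by (simp add: eval)
    show "gen x x * gen z z - gen x z * gen x z \<in> I" "gen y y * gen z z - gen y z * gen y z \<in> I"
      using ideal_diff[OF ideal rel[of x x z z] rel[of x z x z]] ideal_diff[OF ideal rel[of y y z z] rel[of y z y z]]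
        symmetric(2)[of x x z z] symmetric(2)[of y y z z]
      by (simp_all add: eval)
    have 1: "gen x y * gen z z - \<sigma> x y z z \<in> I"
      using rel[of x y z z] by (simp add: eval)
    have 2: "gen x z * gen y z - \<sigma> x y z z - (1/2) *\<^sub>C gen z z \<in> I"
      using rel[of x z y z] symmetric(2)[of x z y z] by (simp add: eval)
    have 3: "gen y z * gen x z - \<sigma> x y z z + (1/2) *\<^sub>C gen z z \<in> I"
      using rel[of y z x z] symmetric(2)[of y z x z] symmetric(1)[of y x z z] by (simp add: eval)
    show "gen x y * gen z z + gen x y * gen z z - (gen x z * gen y z + gen y z * gen x z) \<in> I"
      using ideal_diff[OF ideal ideal_diff[OF ideal ideal_add[OF ideal 1 1] 2] 3] by (simp add: algebra_simps)
    \<comment> \<open>In the Casimir element both the \<open>\<sigma>\<close> terms and the brackets cancel; only the Killing form survives.\<close>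
    let ?K = "\<lambda>a b c d. killing (sp_prod a b) (sp_prod c d :: 'n sp)"
    have \<sigma>: "\<sigma> x y x y = \<sigma> x x y y" "\<sigma> y y x x = \<sigma> x x y y"
      using symmetric(2)[of x y x y] \<sigma>_swap[of y y x x] by simp_all
    have br: "gen_bracket x y x y = 0"
      by (simp add: eval)
    have sum: "(gen x x * gen y y - \<sigma> x x y y - (1/2) *\<^sub>C gen_bracket x x y y - (lam * ?K x x y y) *\<^sub>C 1)
      + (gen y y * gen x x - \<sigma> x x y y - (1/2) *\<^sub>C (- gen_bracket x x y y) - (lam * ?K y y x x) *\<^sub>C 1)
      - ((gen x y * gen x y - \<sigma> x x y y - (1/2) *\<^sub>C 0 - (lam * ?K x y x y) *\<^sub>C 1)
      + (gen x y * gen x y - \<sigma> x x y y - (1/2) *\<^sub>C 0 - (lam * ?K x y x y) *\<^sub>C 1)) \<in> I"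
      using ideal_diff[OF ideal ideal_add[OF ideal rel[of x x y y] rel[of y y x x]] ideal_add[OF ideal rel[of x y x y] rel[of x y x y]]]
      by (simp only: \<sigma> br gen_bracket_swap[of y y x x])
    have "c = lam * ?K x x y y + lam * ?K y y x x - (lam * ?K x y x y + lam * ?K x y x y)"
      by (simp add: killing_sp_prod \<omega> \<omega>' c_def algebra_simps)
    then have c: "c *\<^sub>C (1 :: 'n sp tensor_algebra) =
        (lam * ?K x x y y) *\<^sub>C 1 + (lam * ?K y y x x) *\<^sub>C 1 - ((lam * ?K x y x y) *\<^sub>C 1 + (lam * ?K x y x y) *\<^sub>C 1)"
      by (simp only: cvec.scale_left_distrib cvec.scale_left_diff_distrib)
    show "gen x x * gen y y + gen y y * gen x x - (gen x y * gen x y + gen x y * gen x y) - c *\<^sub>C 1 \<in> I"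
      using sum unfolding c by (simp add: algebra_simps)
  qed
  also have "gen z z * gen z z * (c *\<^sub>C 1 + c *\<^sub>C 1) - (gen z z * gen z z + gen z z * gen z z + gen z z * gen z z) =
      (c + c - (1 + 1 + 1)) *\<^sub>C (gen z z * gen z z)"
    by (simp only: cvec.scale_left_distrib cvec.scale_left_diff_distrib cvec.scale_one distrib_left
        tensor_scale_mult mult_1_right)
  also have "c + c - (1 + 1 + 1) = - 48 * (of_nat CARD('n) + 1) * lam - 3"
    by (simp add: c_def algebra_simps)
  finally show ?thesis .
qed

lemma \<sigma>_in_ideal:
  assumes "lam \<noteq> - 1 / (16 * (of_nat CARD('n) + 1))"
  shows "\<sigma> a b c d \<in> I"
proof -
  define m :: complex where "m = of_nat CARD('n) + 1"
  have m: "m \<noteq> 0"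
    unfolding m_def by (metis of_nat_Suc of_nat_eq_0_iff add.commute nat.distinct(1))
  have "- 48 * m * lam - 3 \<noteq> 0"
  proof
    assume "- 48 * m * lam - 3 = 0"
    then have "3 * (lam * (16 * m)) = 3 * (- 1)" by algebra
    then have "lam * (16 * m) = - 1"
      by (simp only: mult_cancel_left) simp
    moreover have "16 * m \<noteq> 0" using m by simp
    ultimately have "lam = - 1 / (16 * m)"
      by (subst nonzero_eq_divide_eq)
    with assms show False by (simp add: m_def)
  qed
  then have "- 48 * (of_nat CARD('n) + 1) * lam - 3 \<noteq> 0"
    unfolding m_def .
  then have "gen z z * gen z z \<in> I"
    using ideal_scale_cancel[OF ideal casimir_times_square] by blast
  moreover have "gen z z * gen z z - \<sigma> z z z z \<in> I"
    using rel[of z z z z] by (simp add: eval)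
  ultimately have \<sigma>_z: "\<sigma> z z z z \<in> I"
    using ideal_diff[OF ideal] by (metis diff_diff_eq2 add_diff_cancel_left')
  show ?thesis
  proof (rule symmetric_orbit_in_subspace[OF subspace_ideal[OF ideal] symmetric])
    show "\<sigma> (act Z a) b c d + \<sigma> a (act Z b) c d + \<sigma> a b (act Z c) d + \<sigma> a b c (act Z d) \<in> I"
      if "\<sigma> a b c d \<in> I" for Z a b c d
      using that by (rule \<sigma>_invariant)
  qed (rule z_nonzero \<sigma>_z)+
qed

text \<open>With the Cartan product gone, \<open>(xy)(zt) \<equiv> 0\<close> while \<open>(xy)(xz) \<equiv> (zt)(xz) \<equiv> - xz / 2\<close>; evaluating
  \<open>(xy)(zt)(xz)\<close> in both ways gives \<open>xz \<equiv> 0\<close>. The second hyperbolic pair \<open>z, t\<close> is needed here, whence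
  \<open>n \<ge> 2\<close>.\<close>

lemma generators_in_ideal:
  assumes "lam \<noteq> - 1 / (16 * (of_nat CARD('n) + 1))"
  shows "tensor_gen X \<in> I"
proof -
  have rel': "gen a b * gen c d - (1/2) *\<^sub>C gen_bracket a b c d
      - (lam * killing (sp_prod a b) (sp_prod c d :: 'n sp)) *\<^sub>C 1 \<in> I" for a b c d
    using ideal_add[OF ideal rel[of a b c d] \<sigma>_in_ideal[OF assms, of a b c d]] by (simp add: algebra_simps)
  have xz: "gen x z \<in> I"
  proof -
    have h1h2: "gen x y * gen z t \<in> I"
      using rel'[of x y z t] by (simp add: eval)
    have h1: "gen x y * gen x z + (1/2) *\<^sub>C gen x z \<in> I"
      using rel'[of x y x z] by (simp add: eval)
    have h2: "gen z t * gen x z + (1/2) *\<^sub>C gen x z \<in> I"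
      using rel'[of z t x z] by (simp add: eval)
    have "(1/4) *\<^sub>C gen x z = gen x y * gen z t * gen x z - gen x y * (gen z t * gen x z + (1/2) *\<^sub>C gen x z)
        + (1/2) *\<^sub>C (gen x y * gen x z + (1/2) *\<^sub>C gen x z)"
      by (simp add: algebra_simps tensor_scale_mult cvec.scale_right_distrib)
    also have "\<dots> \<in> I"
      by (intro ideal_add[OF ideal] ideal_diff[OF ideal] ideal_mult_right[OF ideal h1h2]
          ideal_mult_left[OF ideal h2] ideal_scale[OF ideal h1])
    finally show ?thesis
      by (rule ideal_scale_cancel[OF ideal]) simp
  qed
  have "(- 2) *\<^sub>C gen y z \<in> I"
    using gen_invariant[OF xz, of "sp_prod y y"]
    by (simp only: act_sp_prod_self \<omega> \<omega>' gen_def sp_prod_linear tensor_gen_scale) (simp add: tensor_gen_zero)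
  then have yz: "gen y z \<in> I"
    by (rule ideal_scale_cancel[OF ideal]) simp
  have zz: "gen z z \<in> I"
    using gen_invariant[OF yz, of "sp_prod x z"] by (simp add: act_sp_prod \<omega> \<omega>' gen_linear)
  have az: "gen a z \<in> I" for a
  proof -
    obtain Z where "act Z z = a"
      using act_transitive[OF z_nonzero] .
    then have "2 *\<^sub>C gen a z \<in> I"
      using gen_invariant[OF zz, of Z] gen_commute[of z a] cvec.scale_left_distrib[of 1 1 "gen a z"] by simp
    then show ?thesis
      by (rule ideal_scale_cancel[OF ideal]) simp
  qed
  have ab: "gen a b \<in> I" for a b
  proof -
    obtain Z where "act Z z = b"
      using act_transitive[OF z_nonzero] .
    then show ?thesis
      using gen_invariant[OF az[of a], of Z] ideal_add_cancel[OF ideal az] by simp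
  qed
  have "X \<in> cvec.span {sp_prod a b | a b. True}"
    unfolding span_sp_prod by simp
  then show ?thesis
  proof (induction rule: cvec.span_induct_alt)
    case base
    show ?case by (simp add: tensor_gen_zero ideal_zero[OF ideal])
  next
    case (step k x y)
    then obtain a b where "x = sp_prod a b" by blast
    then have "tensor_gen x \<in> I"
      using ab[of a b] by (simp add: gen_def)
    with step.IH show ?case
      by (simp add: tensor_gen_add tensor_gen_scale ideal_add[OF ideal] ideal_scale[OF ideal])
  qed
qed

end

end

theorem theorem3p1:
  fixes lam :: complex
    and P :: "'n::finite sp tensor_algebra \<Rightarrow> 'n sp tensor_algebra"
  assumes "CARD('n) \<ge> 2"
    and "lam \<noteq> - 1 / (16 * (of_nat CARD('n) + 1))"
    and "cartan_projection P"
  shows "range (tensor_gen :: 'n sp \<Rightarrow> 'n sp tensor_algebra) \<subseteq>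
    ideal_generated
      {tensor_gen X * tensor_gen Y - P (tensor_gen X * tensor_gen Y)
         - (1/2) *\<^sub>C tensor_gen (bracket X Y) - (lam * killing X Y) *\<^sub>C 1 | X Y. True}"
proof -
  define I where "I = ideal_generated
      {tensor_gen X * tensor_gen Y - P (tensor_gen X * tensor_gen Y)
         - (1/2) *\<^sub>C tensor_gen (bracket X Y) - (lam * killing X Y) *\<^sub>C 1 | X Y. True}"
  interpret symplectic_relations I lam "\<lambda>a b c d. P (sp_tensor a b c d)"
  proof
    show "two_sided_ideal I"
      unfolding I_def by (rule two_sided_ideal_generated)
    fix a b c d
    show "tensor_gen (sp_prod a b) * tensor_gen (sp_prod c d) - P (sp_tensor a b c d)
      - (1/2) *\<^sub>C tensor_gen (bracket (sp_prod a b) (sp_prod c d))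
      - (lam * killing (sp_prod a b) (sp_prod c d)) *\<^sub>C 1 \<in> I"
      unfolding I_def sp_tensor_def by (rule ideal_generated_incl) blast
    show "P (sp_tensor a b c d) = P (sp_tensor b a c d)" "P (sp_tensor a b c d) = P (sp_tensor a c b d)"
      "P (sp_tensor a b c d) = P (sp_tensor a b d c)"
      using projection_symmetric[OF assms(3)] by metis+
    have "cartan_square (P ` tensor_power 2)"
      using assms(3) by (auto simp: cartan_projection_def)
    then show "P (sp_tensor a b c d) \<in> tensor_power 2"
      using sp_tensor_in_tensor_power unfolding cartan_square_def by blast
    show "equivariant (\<lambda>a b c d. P (sp_tensor a b c d))"
      by (rule projection_quadrilinear_equivariant(2)[OF assms(3)])
  qed
  \<comment> \<open>Two distinct indices give two orthogonal hyperbolic pairs of basis vectors.\<close>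
  obtain i j :: 'n where ij: "i \<noteq> j"
  proof -
    have "\<not> CARD('n) \<le> Suc 0" using assms(1) by simp
    then show thesis
      using that by (auto simp: card_le_Suc0_iff_eq)
  qed
  have axis: "axis p (1 :: complex) $ q = 0" if "p \<noteq> q" for p q :: "'n + 'n"
    using that by (simp add: axis_def)
  have "tensor_gen X \<in> I" for X
    by (rule generators_in_ideal[of "axis (Inl i) 1" "axis (Inr i) 1" "axis (Inl j) 1" "axis (Inr j) 1"])
      (use ij assms(2) in \<open>simp_all add: symp_form_axis axis\<close>)
  then show ?thesis
    unfolding I_def by blast
qed

end
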